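(* Let $k,l\ge 2$ and let $n=n_1+\dots+n_k=m_1+\dots+m_l$ be two partitions of $n$ into positive integers. Let $G=U(n)$, let $L=U(n_1)\times U(n_2)\times\cdots\times U(n_k)$ and $H=U(m_1)\times\cdots\times U(m_l)$ be the natural block-diagonal subgroups of $G$, and let $G'=O(n)\subset U(n)$. Put $N:=\min(n_1,\dots,n_k)$ and $M:=\min(m_1,\dots,m_l)$. Then the following five conditions are equivalent: (i) $G=LG'H$, i.e. the multiplication map $L\times G'\times H\to G$, $(x,g,h)\mapsto xgh$, is surjective. (ii) $\mathcal{B}_{m_1,\dots,m_l}(\mathbb{R}^n)\times\mathcal{B}_{n_1,\dots,n_k}(\mathbb{R}^n)$ meets every $G$-orbit of the diagonal $G$-action on $\mathcal{B}_{m_1,\dots,m_l}(\mathbb{C}^n)\times\mathcal{B}_{n_1,\dots,n_k}(\mathbb{C}^n)$. (ii)$'$ $\mathcal{B}_{m_1,\dots,m_l}(\mathbb{R}^n)$ meets every $L$-orbit on $\mathcal{B}_{m_1,\dots,m_l}(\mathbb{C}^n)$. (ii)$''$ $\mathcal{B}_{n_1,\dots,n_k}(\mathbb{R}^n)$ meets every $H$-orbit on $\mathcal{B}_{n_1,\dots,n_k}(\mathbb{C}^n)$. (iii) One of the following holds: 0) $k=2$ and $l=2$; I) $k=3$, $N=1$, $l=2$; II) $k=3$, $N\ge 2$, $l=2$, $M=2$; III) $l=2$, $M=1$; I$'$) $k=2$, $l=3$, $M=1$; II$'$) $k=2$, $N=2$, $l=3$, $M\ge 2$; III$'$) $k=2$,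 $N=1$.
   Context: For a partition $n=m_1+\dots+m_l$ into positive integers, the complex generalized flag variety $\mathcal{B}_{m_1,\dots,m_l}(\mathbb{C}^n)$ is the set of flags $(V_1,\dots,V_l)$ of complex subspaces $\{0\}=V_0\subset V_1\subset\cdots\subset V_l=\mathbb{C}^n$ with $\dim V_i=m_1+\dots+m_i$ for $1\le i\le l$; $U(n)$ acts on it naturally. The real generalized flag variety $\mathcal{B}_{m_1,\dots,m_l}(\mathbb{R}^n)$ is defined likewise with real subspaces of $\mathbb{R}^n$, and is regarded as the (totally real) submanifold of $\mathcal{B}_{m_1,\dots,m_l}(\mathbb{C}^n)$ consisting of complexifications of real flags. Note $G/H\simeq\mathcal{B}_{m_1,\dots,m_l}(\mathbb{C}^n)$ and $G'/(G'\cap H)\simeq\mathcal{B}_{m_1,\dots,m_l}(\mathbb{R}^n)$. *)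

theory Defs
  imports Complex_Main "HOL-Library.Function_Algebras"
begin

text \<open>Vectors of C^n (resp. R^n) are functions nat => complex (resp. real) vanishing at
  indices >= n. Matrices are functions nat => nat => complex vanishing outside the n x n block.\<close>

definition cscale :: "complex \<Rightarrow> (nat \<Rightarrow> complex) \<Rightarrow> (nat \<Rightarrow> complex)" where
  "cscale c v = (\<lambda>i. c * v i)"

definition rscale :: "real \<Rightarrow> (nat \<Rightarrow> real) \<Rightarrow> (nat \<Rightarrow> real)" where
  "rscale c v = (\<lambda>i. c * v i)"

definition cvecs :: "nat \<Rightarrow> (nat \<Rightarrow> complex) set" where
  "cvecs n = {v. \<forall>i\<ge>n. v i = 0}"

definition rvecs :: "nat \<Rightarrow> (nat \<Rightarrow> real) set" where
  "rvecs n = {v. \<forall>i\<ge>n. v i = 0}"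

definition csubspace :: "nat \<Rightarrow> (nat \<Rightarrow> complex) set \<Rightarrow> bool" where
  "csubspace n V \<longleftrightarrow> V \<subseteq> cvecs n \<and> module.subspace cscale V"

definition rsubspace :: "nat \<Rightarrow> (nat \<Rightarrow> real) set \<Rightarrow> bool" where
  "rsubspace n V \<longleftrightarrow> V \<subseteq> rvecs n \<and> module.subspace rscale V"

definition cdim :: "(nat \<Rightarrow> complex) set \<Rightarrow> nat" where
  "cdim V = vector_space.dim cscale V"

definition rdim :: "(nat \<Rightarrow> real) set \<Rightarrow> nat" where
  "rdim V = vector_space.dim rscale V"

text \<open>Generalized flag varieties for the partition ms = [m_1,...,m_l] of n.
  A flag is F :: nat => subspace with F 0 = {0}, F i of dimension m_1+...+m_i,
  F i \<subseteq> F (i+1), F l = whole space; F i = {0} for i > l (canonical padding).\<close>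
definition cflags :: "nat \<Rightarrow> nat list \<Rightarrow> (nat \<Rightarrow> (nat \<Rightarrow> complex) set) set" where
  "cflags n ms = {F.
     (\<forall>i\<le>length ms. csubspace n (F i) \<and> cdim (F i) = sum_list (take i ms)) \<and>
     (\<forall>i<length ms. F i \<subseteq> F (Suc i)) \<and>
     F 0 = {0} \<and> F (length ms) = cvecs n \<and>
     (\<forall>i>length ms. F i = {0})}"

definition rflags :: "nat \<Rightarrow> nat list \<Rightarrow> (nat \<Rightarrow> (nat \<Rightarrow> real) set) set" where
  "rflags n ms = {F.
     (\<forall>i\<le>length ms. rsubspace n (F i) \<and> rdim (F i) = sum_list (take i ms)) \<and>
     (\<forall>i<length ms. F i \<subseteq> F (Suc i)) \<and>
     F 0 = {0} \<and> F (length ms) = rvecs n \<and>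
     (\<forall>i>length ms. F i = {0})}"

text \<open>Complexification of a real subspace / real flag (real flag variety viewed inside the
  complex one).\<close>
definition complexify :: "(nat \<Rightarrow> real) set \<Rightarrow> (nat \<Rightarrow> complex) set" where
  "complexify W = module.span cscale ((\<lambda>v i. complex_of_real (v i)) ` W)"

definition complexify_flag :: "(nat \<Rightarrow> (nat \<Rightarrow> real) set) \<Rightarrow> (nat \<Rightarrow> (nat \<Rightarrow> complex) set)" where
  "complexify_flag W = (\<lambda>i. complexify (W i))"

definition mmul :: "nat \<Rightarrow> (nat \<Rightarrow> nat \<Rightarrow> complex) \<Rightarrow> (nat \<Rightarrow> nat \<Rightarrow> complex) \<Rightarrow> (nat \<Rightarrow> nat \<Rightarrow> complex)" where
  "mmul n A B = (\<lambda>i j. if i < n \<and> j < n then (\<Sum>k<n. A i k * B k j) else 0)"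

definition mvec :: "nat \<Rightarrow> (nat \<Rightarrow> nat \<Rightarrow> complex) \<Rightarrow> (nat \<Rightarrow> complex) \<Rightarrow> (nat \<Rightarrow> complex)" where
  "mvec n A v = (\<lambda>i. if i < n then (\<Sum>j<n. A i j * v j) else 0)"

definition flag_act :: "nat \<Rightarrow> (nat \<Rightarrow> nat \<Rightarrow> complex) \<Rightarrow> (nat \<Rightarrow> (nat \<Rightarrow> complex) set) \<Rightarrow> (nat \<Rightarrow> (nat \<Rightarrow> complex) set)" where
  "flag_act n A F = (\<lambda>i. mvec n A ` F i)"

definition unitary_group :: "nat \<Rightarrow> (nat \<Rightarrow> nat \<Rightarrow> complex) set" where
  "unitary_group n = {A. (\<forall>i j. \<not> (i < n \<and> j < n) \<longrightarrow> A i j = 0) \<and>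
     (\<forall>i<n. \<forall>j<n. (\<Sum>k<n. cnj (A k i) * A k j) = (if i = j then 1 else 0))}"

definition orthogonal_group :: "nat \<Rightarrow> (nat \<Rightarrow> nat \<Rightarrow> complex) set" where
  "orthogonal_group n = {A \<in> unitary_group n. \<forall>i j. A i j \<in> \<real>}"

definition block_of :: "nat list \<Rightarrow> nat \<Rightarrow> nat" where
  "block_of ns i = (LEAST b. i < sum_list (take (Suc b) ns))"

definition block_unitary :: "nat \<Rightarrow> nat list \<Rightarrow> (nat \<Rightarrow> nat \<Rightarrow> complex) set" where
  "block_unitary n ns = {A \<in> unitary_group n.
     \<forall>i<n. \<forall>j<n. block_of ns i \<noteq> block_of ns j \<longrightarrow> A i j = 0}"

end

theory Submission
  imports Defs "Jordan_Normal_Form.Spectral_Radius"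
begin

text \<open>
  By transitivity of \<open>U(n)\<close> and \<open>O(n)\<close> on complex and real flags, all conditions except the numerical
  one say that every unitary \<open>g\<close> factors as \<open>x r h\<close> with \<open>r\<close> real orthogonal. Cut the columns of \<open>g\<close>
  in a block \<open>J\<close> of \<open>ms\<close> along the blocks of \<open>ns\<close>, and let \<open>P\<^sub>1, ..., P\<^sub>k\<close> be the Gram matrices
  (of size \<open>|J|\<close>) of the pieces; they add up to the identity.

  Sufficiency, for \<open>l = 2\<close>: \<open>g\<close> factors as soon as one unitary conjugation makes all \<open>P\<^sub>a\<close> real,
  because vectors with real Gram matrix can be rotated into real vectors. One \<open>P\<^sub>a\<close> can be
  diagonalised, which settles \<open>k = 2\<close>. For \<open>k = 3\<close> a diagonal unitary can moreover make a second
  one real if it has rank one or size two, and for \<open>|J| = 1\<close> nothing has to be done.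

  Necessity: if \<open>g = x r h\<close>, then the complex conjugate of \<open>g\<close> is \<open>y g z\<close> with \<open>y \<in> L\<close>, \<open>z \<in> H\<close>,
  hence all words in the Gram matrices and in the projections to blocks of \<open>ms\<close> have real trace.
  Explicit configurations with 3, 4 and 6 rows violate this in the cases \<open>k, l \<ge> 3\<close>;
  \<open>l = 2, k \<ge> 4, M \<ge> 2\<close>; and \<open>l = 2, k = 3, N \<ge> 2, M \<ge> 3\<close>.
\<close>

subsection \<open>Orthonormal families over the real and the complex numbers\<close>

text \<open>The numerical list is a count of phases. After one Gram matrix is diagonal with distinct
  eigenvalues, only diagonal unitaries (up to permutation) preserve that shape, and the sum relation
  makes one more matrix dependent, so \<open>k - 2\<close> matrices are left to be made real by
  phases alone. Phases cannot change cyclic products such as \<open>Y01 * Y12 * Y20\<close>. For one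
  remaining matrix these are automatically real in size two or rank one; for two remaining matrices
  of size two, the product of an off-diagonal entry of one with the transposed entry of the other is
  already an obstruction. The case \<open>l = 2\<close> is special because real columns in one block
  extend to a real orthogonal matrix, and the discrepancy lives on the complement, which is then the
  other block. The cases with \<open>k = 2\<close> follow by taking adjoints. For the converse, the
  obstruction must be visible in every larger \<open>U(n)\<close> and for every choice of factors.
  Traces of words are invariant under \<open>L\<close> and \<open>H\<close>, and a small bad matrix
  can be padded by columns that contribute only real numbers.\<close>

locale coord_space =
  fixes cj :: "'a::real_normed_field \<Rightarrow> 'a" and scl :: "'a \<Rightarrow> (nat \<Rightarrow> 'a) \<Rightarrow> nat \<Rightarrow> 'a" and n :: nat
  assumes cj_add: "cj (x + y) = cj x + cj y"
    and cj_mult: "cj (x * y) = cj x * cj y"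
    and cj_cj: "cj (cj x) = x"
    and cj_self: "cj x * x = of_real ((norm x)\<^sup>2)"
    and cj_of_real: "cj (of_real r) = of_real r"
    and scl_eq: "scl c v = (\<lambda>i. c * v i)"
begin

text \<open>\<open>scl\<close> is a locale parameter with a prescribed formula so that the
  \<open>span\<close> and \<open>dim\<close> obtained here become, after interpretation, those of
  \<open>cscale\<close> and \<open>rscale\<close> in the definitions of flags.\<close>

sublocale vector_space scl
  by unfold_locales (auto simp: scl_eq fun_eq_iff algebra_simps)

lemma cj_0: "cj 0 = 0" and cj_1: "cj 1 = 1"
  using cj_of_real[of 0] cj_of_real[of 1] by simp_all

lemma cj_sum: "cj (\<Sum>x\<in>A. f x) = (\<Sum>x\<in>A. cj (f x))"
  by (induction A rule: infinite_finite_induct) (auto simp: cj_add cj_0)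

definition vecs :: "(nat \<Rightarrow> 'a) set" where
  "vecs = {v. \<forall>i\<ge>n. v i = 0}"

definition ip :: "(nat \<Rightarrow> 'a) \<Rightarrow> (nat \<Rightarrow> 'a) \<Rightarrow> 'a" where
  "ip v w = (\<Sum>i<n. cj (v i) * w i)"

definition onf :: "nat set \<Rightarrow> (nat \<Rightarrow> nat \<Rightarrow> 'a) \<Rightarrow> bool" where
  "onf I e \<longleftrightarrow> (\<forall>i\<in>I. e i \<in> vecs) \<and> (\<forall>i\<in>I. \<forall>j\<in>I. ip (e i) (e j) = (if i = j then 1 else 0))"

definition unit_vec :: "nat \<Rightarrow> nat \<Rightarrow> 'a" where
  "unit_vec r = (\<lambda>i. if i = r then 1 else 0)"

lemma subspace_vecs: "subspace vecs"
  by (auto simp: subspace_def vecs_def scl_eq)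

lemma ip_add_right: "ip v (w + w') = ip v w + ip v w'"
  by (simp add: ip_def algebra_simps sum.distrib)

lemma ip_diff_right: "ip v (w - w') = ip v w - ip v w'"
  by (simp add: ip_def algebra_simps sum_subtractf)

lemma ip_scale_right: "ip v (scl c w) = c * ip v w"
  by (simp add: ip_def scl_eq sum_distrib_left mult_ac)

lemma ip_zero_right [simp]: "ip v 0 = 0"
  by (simp add: ip_def)

lemma ip_sum_right: "ip v (\<Sum>r\<in>A. f r) = (\<Sum>r\<in>A. ip v (f r))"
  by (induction A rule: infinite_finite_induct) (simp_all only: sum.infinite sum.empty sum.insert ip_zero_right ip_add_right not_False_eq_True)

lemma ip_commute: "ip w v = cj (ip v w)"
  by (simp add: ip_def cj_sum cj_mult cj_cj mult.commute)

lemma ip_self: "ip v v = of_real (\<Sum>i<n. (norm (v i))\<^sup>2)"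
  by (simp add: ip_def cj_self)

lemma ip_self_eq_0: 
  assumes "v \<in> vecs" "ip v v = 0" shows "v = 0"
proof
  fix i
  have "(\<Sum>i<n. (norm (v i))\<^sup>2) = 0" using assms(2) unfolding ip_self by (simp only: of_real_eq_0_iff)
  then have "\<forall>i\<in>{..<n}. (norm (v i))\<^sup>2 = 0" by (subst (asm) sum_nonneg_eq_0_iff) auto
  then show "v i = 0 i" using assms(1) by (cases "i < n") (auto simp: vecs_def)
qed

lemma ip_orth_span:
  assumes "\<And>w. w \<in> T \<Longrightarrow> ip v w = 0" "w \<in> span T"
  shows "ip v w = 0"
proof -
  have "subspace {w. ip v w = 0}"
    using ip_add_right ip_scale_right by (auto simp: subspace_def)
  moreover have "T \<subseteq> {w. ip v w = 0}" using assms by auto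
  ultimately have "span T \<subseteq> {w. ip v w = 0}" by (rule span_minimal[rotated])
  then show ?thesis using assms by auto
qed

lemma onf_inj_on: assumes "onf I e" shows "inj_on e I"
proof (rule inj_onI)
  fix i j assume *: "i \<in> I" "j \<in> I" "e i = e j"
  have "ip (e i) (e j) = 1" using * assms by (simp add: onf_def)
  then show "i = j" using * assms unfolding onf_def by (metis zero_neq_one)
qed

lemma onf_subset: "onf I e \<Longrightarrow> J \<subseteq> I \<Longrightarrow> onf J e"
  unfolding onf_def by blast

lemma onf_insert:
  assumes "onf I e" "r \<notin> I" "v \<in> vecs" "ip v v = 1" "\<And>i. i \<in> I \<Longrightarrow> ip (e i) v = 0"
  shows "onf (insert r I) (e(r := v))"
proof -
  have "ip v (e i) = 0" if "i \<in> I" for i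
    using assms(5)[OF that] by (subst ip_commute) (simp add: cj_0)
  then show ?thesis using assms by (auto simp: onf_def)
qed

lemma onf_independent:
  assumes "finite I" "onf I e" shows "independent (e ` I)"
  using assms
proof (induction I rule: finite_induct)
  case empty
  show ?case unfolding image_empty by (rule independent_empty)
next
  case (insert i I)
  have "onf I e" using insert.prems onf_subset by blast
  then have ind: "independent (e ` I)" using insert by simp
  have "e i \<notin> span (e ` I)"
  proof
    assume a: "e i \<in> span (e ` I)"
    have "ip (e i) (e i) = 0"
      using insert.prems insert.hyps by (intro ip_orth_span[OF _ a]) (auto simp: onf_def)
    then show False using insert.prems by (simp add: onf_def)
  qed
  then show ?case using ind by (simp add: independent_insertI)
qed

lemma onf_unit_vec: "onf {..<n} unit_vec"
  by (auto simp: onf_def vecs_def ip_def unit_vec_def cj_0 cj_1 if_distrib[of cj] if_distrib[of "\<lambda>x. x * _"] cong: if_cong)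

lemma sum_fun_apply: "(\<Sum>r\<in>A. f r) i = (\<Sum>r\<in>A. f r i)" for f :: "nat \<Rightarrow> nat \<Rightarrow> 'a"
  by (induction A rule: infinite_finite_induct) auto

lemma span_unit_vec: 
  assumes "d \<le> n" shows "span (unit_vec ` {..<d}) = {v. \<forall>i\<ge>d. v i = 0}"
proof
  show "span (unit_vec ` {..<d}) \<subseteq> {v. \<forall>i\<ge>d. v i = 0}"
    by (rule span_minimal) (auto simp: unit_vec_def subspace_def scl_eq)
  show "{v. \<forall>i\<ge>d. v i = 0} \<subseteq> span (unit_vec ` {..<d})"
  proof
    fix v :: "nat \<Rightarrow> 'a" assume "v \<in> {v. \<forall>i\<ge>d. v i = 0}"
    then have v: "v i = 0" if "i \<ge> d" for i using that by simp
    have "v = (\<Sum>r<d. scl (v r) (unit_vec r))"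
    proof
      fix i show "v i = (\<Sum>r<d. scl (v r) (unit_vec r)) i"
        using v[of i] by (simp add: sum_fun_apply scl_eq unit_vec_def if_distrib[of "\<lambda>x. _ * x"] cong: if_cong)
    qed
    also have "\<dots> \<in> span (unit_vec ` {..<d})"
      by (intro span_sum span_scale span_base) auto
    finally show "v \<in> span (unit_vec ` {..<d})" .
  qed
qed

lemma vecs_eq_span: "vecs = span (unit_vec ` {..<n})"
  by (simp add: span_unit_vec vecs_def)

lemma onf_card_le:
  assumes "onf I e" "finite I" "e ` I \<subseteq> span T" "finite T" shows "card I \<le> card T"
proof -
  have "card (e ` I) \<le> card T"
    using independent_span_bound[OF assms(4) onf_independent[OF assms(2,1)] assms(3)] by simp
  then show ?thesis using onf_inj_on[OF assms(1)] by (simp add: card_image)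
qed

text \<open>One Gram-Schmidt step kept inside \<open>V\<close>: a vector of \<open>V\<close> outside
  the span has a nonzero residue after projection, which is normalised. Staying in \<open>V\<close>
  serves both the completion of bases and the bases adapted to flags.\<close>

lemma exists_unit_orthogonal:
  assumes V: "subspace V" "V \<subseteq> vecs" and I: "finite I" "onf I e" "e ` I \<subseteq> V" and ns: "\<not> V \<subseteq> span (e ` I)"
  shows "\<exists>v\<in>V. ip v v = 1 \<and> (\<forall>i\<in>I. ip (e i) v = 0)"
proof -
  obtain w where w: "w \<in> V" "w \<notin> span (e ` I)" using ns by auto
  define p where "p = (\<Sum>i\<in>I. scl (ip (e i) w) (e i))"
  have pS: "p \<in> span (e ` I)" unfolding p_def by (intro span_sum span_scale span_base) auto
  have "span (e ` I) \<subseteq> V" using V(1) I(3) by (intro span_minimal)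
  then have u: "w - p \<in> V" using V(1) w pS by (intro subspace_diff) auto
  have u0: "w - p \<noteq> 0" using w(2) pS by auto
  have orth: "ip (e i) (w - p) = 0" if "i \<in> I" for i
  proof -
    have "ip (e i) p = (\<Sum>j\<in>I. ip (e j) w * ip (e i) (e j))"
      unfolding p_def ip_sum_right by (simp add: ip_scale_right)
    also have "\<dots> = (\<Sum>j\<in>I. if j = i then ip (e i) w else 0)"
      using I(2) that by (intro sum.cong) (auto simp: onf_def)
    also have "\<dots> = ip (e i) w" using I(1) that by simp
    finally show ?thesis by (simp add: ip_diff_right)
  qed
  define s where "s = (\<Sum>i<n. (norm ((w - p) i))\<^sup>2)"
  have s0: "s \<noteq> 0"
    using ip_self_eq_0[of "w - p"] u u0 V(2) unfolding ip_self s_def by (metis of_real_0 subsetD)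
  have "s \<ge> 0" unfolding s_def by (intro sum_nonneg) simp
  then have s: "s > 0" using s0 by simp
  define v where "v = scl (of_real (1 / sqrt s)) (w - p)"
  have "v \<in> V" unfolding v_def using V(1) u by (intro subspace_scale)
  moreover have "ip v v = 1"
  proof -
    have "ip v v = of_real (1 / sqrt s) * ip v (w - p)"
      unfolding v_def by (simp only: ip_scale_right)
    also have "ip v (w - p) = cj (of_real (1 / sqrt s) * ip (w - p) (w - p))"
      unfolding v_def ip_scale_right[symmetric] by (rule ip_commute)
    also have "\<dots> = of_real (1 / sqrt s) * of_real s"
      unfolding ip_self s_def[symmetric] cj_mult cj_of_real ..
    also have "of_real (1 / sqrt s) * (of_real (1 / sqrt s) * of_real s) = (of_real (1 / sqrt s * (1 / sqrt s * s)) :: 'a)"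
      by (simp only: of_real_mult)
    also have "1 / sqrt s * (1 / sqrt s * s) = 1" using s by (simp add: real_div_sqrt)
    finally show ?thesis by simp
  qed
  moreover have "ip (e i) v = 0" if "i \<in> I" for i
    unfolding v_def ip_scale_right orth[OF that] by (rule mult_zero_right)
  ultimately show ?thesis by blast
qed

text \<open>The prescribed indices may form any subset of \<open>{..<n}\<close>, because later
  proofs fix the columns of a whole block. The induction fills one missing index at a time; a
  dimension count shows that fewer than \<open>n\<close> vectors leave a direction free.\<close>

lemma onf_extend:
  assumes "I \<subseteq> {..<n}" "onf I e"
  shows "\<exists>f. onf {..<n} f \<and> (\<forall>i\<in>I. f i = e i)"
  using assms
proof (induction "card ({..<n} - I)" arbitrary: I e)
  case 0
  then have "I = {..<n}" by auto
  then show ?case using 0 by blast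
next
  case (Suc m)
  then have "{..<n} - I \<noteq> {}" by (metis card.empty nat.simps(3))
  then obtain r where r: "r < n" "r \<notin> I" by auto
  have fin: "finite I" using Suc.prems finite_subset by blast
  have "card I < n" using r Suc.prems(1)
    by (metis card_lessThan finite_lessThan lessThan_iff psubsetI psubset_card_mono)
  have "\<not> vecs \<subseteq> span (e ` I)"
  proof
    assume "vecs \<subseteq> span (e ` I)"
    then have "unit_vec ` {..<n} \<subseteq> span (e ` I)" using onf_unit_vec by (auto simp: onf_def)
    then have "n \<le> card (e ` I)" using onf_card_le[OF onf_unit_vec] fin by auto
    also have "\<dots> \<le> card I" by (rule card_image_le[OF fin])
    finally show False using \<open>card I < n\<close> by simp
  qed
  then obtain v where v: "v \<in> vecs" "ip v v = 1" "\<forall>i\<in>I. ip (e i) v = 0"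
    using exists_unit_orthogonal[of vecs I e] subspace_vecs Suc.prems fin by (auto simp: onf_def)
  have "onf (insert r I) (e(r := v))" using onf_insert Suc.prems r v by blast
  moreover have "m = card ({..<n} - insert r I)"
  proof -
    have "{..<n} - insert r I = ({..<n} - I) - {r}" by auto
    then show ?thesis using Suc.hyps(2) r by (simp add: card_Diff_singleton)
  qed
  moreover have "insert r I \<subseteq> {..<n}" using r Suc.prems by auto
  ultimately obtain f where f: "onf {..<n} f" "\<forall>i\<in>insert r I. f i = (e(r := v)) i"
    using Suc.hyps(1)[of "insert r I" "e(r := v)"] by blast
  have "\<forall>i\<in>I. f i = e i" using f(2) r by auto
  then show ?case using f(1) by blast
qed

lemma onf_span_subspace:
  assumes V: "subspace V" "V \<subseteq> vecs" and f: "onf {..<d} f" "f ` {..<d} \<subseteq> V" and d: "d = dim V"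
  shows "V = span (f ` {..<d})"
proof
  show "span (f ` {..<d}) \<subseteq> V" using V(1) f(2) by (intro span_minimal)
  show "V \<subseteq> span (f ` {..<d})"
  proof (rule ccontr)
    assume "\<not> V \<subseteq> span (f ` {..<d})"
    then obtain v where v: "v \<in> V" "ip v v = 1" "\<forall>i\<in>{..<d}. ip (f i) v = 0"
      using exists_unit_orthogonal[of V "{..<d}" f] V f by auto
    have *: "onf (insert d {..<d}) (f(d := v))" using onf_insert[OF f(1)] v V(2) by auto
    obtain B where B: "B \<subseteq> V" "independent B" "V \<subseteq> span B" "card B = dim V"
      by (rule basis_exists)
    \<comment> \<open>A basis of \<open>V\<close> is not finite by definition; the \<open>n\<close>
      unit vectors bound its size.\<close>
    have "finite B"
      using independent_span_bound[of "unit_vec ` {..<n}" B] B V(2) vecs_eq_span by auto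
    have "f(d := v) ` insert d {..<d} \<subseteq> span B" using f(2) v(1) B(3) by auto
    then have "card (insert d {..<d}) \<le> card B"
      using onf_card_le[OF *] \<open>finite B\<close> by auto
    then show False using B(4) d by simp
  qed
qed

lemma onf_span_properties:
  assumes "onf {..<n} f" "d \<le> n"
  shows "subspace (span (f ` {..<d}))" "span (f ` {..<d}) \<subseteq> vecs" "dim (span (f ` {..<d})) = d"
proof -
  have o: "onf {..<d} f" using assms onf_subset[of "{..<n}" f "{..<d}"] by auto
  show "subspace (span (f ` {..<d}))" by (rule subspace_span)
  show "span (f ` {..<d}) \<subseteq> vecs" using o subspace_vecs by (intro span_minimal) (auto simp: onf_def)
  have "dim (span (f ` {..<d})) = card (f ` {..<d})"
    using dim_span_eq_card_independent onf_independent[OF _ o] by simp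
  also have "\<dots> = d" using onf_inj_on[OF o] by (simp add: card_image)
  finally show "dim (span (f ` {..<d})) = d" .
qed

lemma dim_vecs: "dim vecs = n"
  using onf_span_properties(3)[OF onf_unit_vec order_refl] vecs_eq_span by simp

lemma onf_span_vecs: "onf {..<n} f \<Longrightarrow> span (f ` {..<n}) = vecs"
  using onf_span_subspace[of vecs n f] subspace_vecs dim_vecs by (auto simp: onf_def)

text \<open>Expanding the unit vector at \<open>j\<close> in the orthonormal basis and reading off
  coordinate \<open>i\<close> turns orthonormal columns into orthonormal rows; this is how a left
  inverse of a matrix becomes a right inverse.\<close>

lemma onf_rows:
  assumes "onf {..<n} f" "i < n" "j < n"
  shows "(\<Sum>r<n. f r i * cj (f r j)) = (if i = j then 1 else 0)"
proof -
  have ex: "v = (\<Sum>r<n. scl (ip (f r) v) (f r))" (is "_ = ?p v") if "v \<in> vecs" for v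
  proof -
    have "?p v \<in> span (f ` {..<n})" by (intro span_sum span_scale span_base) auto
    then have pv: "?p v \<in> vecs" using onf_span_vecs[OF assms(1)] by simp
    then have d: "v - ?p v \<in> vecs" using that subspace_vecs by (intro subspace_diff)
    have "ip (f s) (v - ?p v) = 0" if "s < n" for s
    proof -
      have "ip (f s) (?p v) = (\<Sum>r<n. ip (f r) v * ip (f s) (f r))"
        unfolding ip_sum_right by (simp add: ip_scale_right)
      also have "\<dots> = (\<Sum>r<n. if r = s then ip (f s) v else 0)"
        using assms(1) that by (intro sum.cong) (auto simp: onf_def)
      finally show ?thesis using that by (simp add: ip_diff_right)
    qed
    then have "ip (v - ?p v) w = 0" if "w \<in> f ` {..<n}" for w
      using that by (subst ip_commute) (auto simp: cj_0)
    then have "ip (v - ?p v) (v - ?p v) = 0"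
      by (rule ip_orth_span) (use d onf_span_vecs[OF assms(1)] in auto)
    then have "v - ?p v = 0" using d by (rule ip_self_eq_0[rotated])
    then show ?thesis by simp
  qed
  have u: "unit_vec j \<in> vecs" using assms(3) by (auto simp: vecs_def unit_vec_def)
  have "(\<Sum>r<n. f r i * cj (f r j)) = (\<Sum>r<n. scl (ip (f r) (unit_vec j)) (f r)) i"
    using assms by (simp add: sum_fun_apply scl_eq ip_def unit_vec_def mult.commute if_distrib[of "\<lambda>x. _ * x"] if_distrib[of "\<lambda>x. x * _"] cong: if_cong)
  also have "\<dots> = unit_vec j i" using ex[OF u] by metis
  finally show ?thesis by (simp add: unit_vec_def)
qed

lemma flag_adapted_basis:
  fixes F :: "nat \<Rightarrow> (nat \<Rightarrow> 'a) set"
  assumes F: "\<And>i. i \<le> l \<Longrightarrow> subspace (F i) \<and> F i \<subseteq> vecs \<and> dim (F i) = d i"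
    and mono: "\<And>i. i < l \<Longrightarrow> F i \<subseteq> F (Suc i)" and dl: "d l = n" and dm: "\<And>i. i \<le> l \<Longrightarrow> d i \<le> n"
  shows "\<exists>f. onf {..<n} f \<and> (\<forall>i\<le>l. F i = span (f ` {..<d i}))"
proof -
  have mono': "F i \<subseteq> F j" if "i \<le> j" "j \<le> l" for i j
    using that
  proof (induction rule: dec_induct)
    case (step m)
    then show ?case using mono[of m] by auto
  qed simp
  have "\<exists>f. onf {..<r} f \<and> (\<forall>s<r. \<forall>i\<le>l. s < d i \<longrightarrow> f s \<in> F i)" if "r \<le> n" for r
    using that
  proof (induction r)
    case 0
    then show ?case by (auto simp: onf_def)
  next
    case (Suc r)
    then obtain f where f: "onf {..<r} f" "\<forall>s<r. \<forall>i\<le>l. s < d i \<longrightarrow> f s \<in> F i" by auto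
    \<comment> \<open>The new vector comes from the first member of the flag of dimension above
      \<open>r\<close>; by monotonicity it then lies in every member that has to contain it.\<close>
    define i0 where "i0 = (LEAST i. r < d i)"
    have rl: "r < d l" using Suc.prems dl by simp
    then have i0: "r < d i0" unfolding i0_def by (rule LeastI)
    have i0le: "i0 \<le> i" if "r < d i" for i unfolding i0_def using that by (rule Least_le)
    have i0l: "i0 \<le> l" using i0le rl by simp
    have "\<not> F i0 \<subseteq> span (f ` {..<r})"
    proof
      assume "F i0 \<subseteq> span (f ` {..<r})"
      then have "dim (F i0) \<le> card (f ` {..<r})" by (intro dim_le_card) auto
      also have "\<dots> \<le> r" using card_image_le[of "{..<r}" f] by simp
      finally show False using F[OF i0l] i0 by simp
    qed
    then obtain v where v: "v \<in> F i0" "ip v v = 1" "\<forall>i\<in>{..<r}. ip (f i) v = 0"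
      using exists_unit_orthogonal[of "F i0" "{..<r}" f] F[OF i0l] f i0l i0 by fastforce
    have "onf (insert r {..<r}) (f(r := v))" using onf_insert[OF f(1)] v F[OF i0l] by auto
    moreover have "(f(r := v)) s \<in> F i" if "s < Suc r" "i \<le> l" "s < d i" for s i
      using that f(2) v(1) mono'[of i0 i] i0le[of i] by (cases "s = r") auto
    ultimately show ?case by (auto simp: lessThan_Suc intro!: exI[of _ "f(r := v)"])
  qed
  then obtain f where f: "onf {..<n} f" "\<forall>s<n. \<forall>i\<le>l. s < d i \<longrightarrow> f s \<in> F i" by blast
  have "F i = span (f ` {..<d i})" if "i \<le> l" for i
    using that F[OF that] f dm[OF that] onf_subset[OF f(1), of "{..<d i}"]
    by (intro onf_span_subspace) auto
  then show ?thesis using f(1) by blast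
qed

end

interpretation C: coord_space cnj cscale n for n :: nat
proof
  show "cnj x * x = of_real ((norm x)\<^sup>2)" for x
    using complex_norm_square[of x] by (simp only: mult.commute)
qed (simp_all add: cscale_def)

interpretation R: coord_space "\<lambda>x::real. x" rscale n for n :: nat
  by unfold_locales (simp_all add: power2_eq_square rscale_def)

lemma cvecs_eq: "cvecs n = C.vecs n" and rvecs_eq: "rvecs n = R.vecs n"
  unfolding cvecs_def rvecs_def C.vecs_def R.vecs_def by (rule refl)+

subsection \<open>Unitary matrices and flags\<close>

definition madj :: "(nat \<Rightarrow> nat \<Rightarrow> complex) \<Rightarrow> nat \<Rightarrow> nat \<Rightarrow> complex" where
  "madj A = (\<lambda>i j. cnj (A j i))"

definition mconj :: "(nat \<Rightarrow> nat \<Rightarrow> complex) \<Rightarrow> nat \<Rightarrow> nat \<Rightarrow> complex" where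
  "mconj A = (\<lambda>i j. cnj (A i j))"

definition mid :: "nat \<Rightarrow> nat \<Rightarrow> nat \<Rightarrow> complex" where
  "mid n = (\<lambda>i j. if i = j \<and> i < n then 1 else 0)"

text \<open>Matrix equality is equality of functions on all of \<open>nat\<close>, so
  \<open>mid n\<close> acts as an identity only on matrices in this set.\<close>

definition mats :: "nat \<Rightarrow> (nat \<Rightarrow> nat \<Rightarrow> complex) set" where
  "mats n = {A. \<forall>i j. \<not> (i < n \<and> j < n) \<longrightarrow> A i j = 0}"

lemma mmul_mats [simp]: "mmul n A B \<in> mats n"
  by (simp add: mats_def mmul_def)

lemma mid_mats [simp]: "mid n \<in> mats n"
  by (simp add: mats_def mid_def)

lemma madj_mats [simp]: "A \<in> mats n \<Longrightarrow> madj A \<in> mats n"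
  by (auto simp: mats_def madj_def)

lemma mmul_assoc: "mmul n (mmul n A B) C = mmul n A (mmul n B C)"
proof (intro ext)
  fix i j
  have "(\<Sum>k<n. (\<Sum>m<n. A i m * B m k) * C k j) = (\<Sum>m<n. A i m * (\<Sum>k<n. B m k * C k j))"
    by (simp add: sum_distrib_left sum_distrib_right mult.assoc) (rule sum.swap)
  then show "mmul n (mmul n A B) C i j = mmul n A (mmul n B C) i j"
    by (simp add: mmul_def)
qed

lemma mmul_mid_left [simp]: "A \<in> mats n \<Longrightarrow> mmul n (mid n) A = A"
  by (intro ext) (auto simp: mmul_def mid_def mats_def if_distrib[of "\<lambda>x. x * _"] cong: if_cong)

lemma mmul_mid_right [simp]: "A \<in> mats n \<Longrightarrow> mmul n A (mid n) = A"
  by (intro ext) (auto simp: mmul_def mid_def mats_def if_distrib[of "\<lambda>x. _ * x"] cong: if_cong)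

lemma madj_mmul: "madj (mmul n A B) = mmul n (madj B) (madj A)"
  by (intro ext) (auto simp: madj_def mmul_def mult.commute)

lemma madj_madj [simp]: "madj (madj A) = A"
  by (simp add: madj_def)

lemma madj_mid [simp]: "madj (mid n) = mid n"
  by (intro ext) (auto simp: madj_def mid_def)

lemma mconj_mmul: "mconj (mmul n A B) = mmul n (mconj A) (mconj B)"
  by (intro ext) (auto simp: mconj_def mmul_def)

lemma unitary_iff: "A \<in> unitary_group n \<longleftrightarrow> A \<in> mats n \<and> mmul n (madj A) A = mid n"
  by (auto simp: unitary_group_def mats_def mmul_def madj_def mid_def fun_eq_iff)

lemma unitary_iff_onf: "A \<in> unitary_group n \<longleftrightarrow> A \<in> mats n \<and> C.onf n {..<n} (\<lambda>r i. A i r)"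
  unfolding unitary_group_def mats_def C.onf_def C.vecs_def C.ip_def by auto

lemma unitary_mats: "A \<in> unitary_group n \<Longrightarrow> A \<in> mats n"
  by (simp add: unitary_iff)

lemma unitary_adj_left: "A \<in> unitary_group n \<Longrightarrow> mmul n (madj A) A = mid n"
  by (simp add: unitary_iff)

lemma unitary_adj_right: 
  assumes "A \<in> unitary_group n" shows "mmul n A (madj A) = mid n"
proof (intro ext)
  fix i j
  have "C.onf n {..<n} (\<lambda>r i. A i r)" using assms unitary_iff_onf by blast
  from C.onf_rows[OF this] show "mmul n A (madj A) i j = mid n i j"
    by (auto simp: mmul_def madj_def mid_def)
qed

lemma unitary_adj: "A \<in> unitary_group n \<Longrightarrow> madj A \<in> unitary_group n"
  using unitary_adj_right[of A n] unitary_mats[of A n] by (simp add: unitary_iff[of "madj A"])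

lemma unitary_mid [simp]: "mid n \<in> unitary_group n"
  by (simp add: unitary_iff)

lemma unitary_cancel_left: "A \<in> unitary_group n \<Longrightarrow> B \<in> mats n \<Longrightarrow> mmul n (madj A) (mmul n A B) = B"
  by (simp add: mmul_assoc[symmetric] unitary_adj_left)

lemma unitary_cancel_left': "A \<in> unitary_group n \<Longrightarrow> B \<in> mats n \<Longrightarrow> mmul n A (mmul n (madj A) B) = B"
  by (simp add: mmul_assoc[symmetric] unitary_adj_right)

lemma unitary_mmul:
  assumes "A \<in> unitary_group n" "B \<in> unitary_group n" shows "mmul n A B \<in> unitary_group n"
  using assms unitary_cancel_left[OF assms(1) unitary_mats[OF assms(2)]]
  by (simp add: unitary_iff[of "mmul n A B"] madj_mmul mmul_assoc unitary_adj_left)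

lemma unitary_conj: "A \<in> unitary_group n \<Longrightarrow> mconj A \<in> unitary_group n"
proof -
  assume A: "A \<in> unitary_group n"
  have "madj (mconj A) = mconj (madj A)" by (simp add: madj_def mconj_def)
  then have "mmul n (madj (mconj A)) (mconj A) = mconj (mid n)"
    using unitary_adj_left[OF A] by (simp flip: mconj_mmul)
  also have "mconj (mid n) = mid n" by (intro ext) (auto simp: mid_def mconj_def)
  finally show ?thesis using unitary_mats[OF A] by (auto simp: unitary_iff mats_def mconj_def)
qed

lemma orthogonal_unitary: "A \<in> orthogonal_group n \<Longrightarrow> A \<in> unitary_group n"
  by (simp add: orthogonal_group_def)

lemma orthogonal_mmul:
  "A \<in> orthogonal_group n \<Longrightarrow> B \<in> orthogonal_group n \<Longrightarrow> mmul n A B \<in> orthogonal_group n"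
  using unitary_mmul[of A n B] unfolding orthogonal_group_def
  by (auto simp: mmul_def intro!: sum_in_Reals Reals_mult)

lemma orthogonal_adj: "A \<in> orthogonal_group n \<Longrightarrow> madj A \<in> orthogonal_group n"
  using unitary_adj[of A n] unfolding orthogonal_group_def by (auto simp: madj_def Reals_cnj_iff)

lemma orthogonal_mid [simp]: "mid n \<in> orthogonal_group n"
  using unitary_mid[of n] unfolding orthogonal_group_def by (auto simp: mid_def simp del: unitary_mid)

lemma block_unitary_unitary: "A \<in> block_unitary n ns \<Longrightarrow> A \<in> unitary_group n"
  by (simp add: block_unitary_def)

lemma block_unitary_mmul:
  assumes "A \<in> block_unitary n ns" "B \<in> block_unitary n ns" shows "mmul n A B \<in> block_unitary n ns"
proof -
  have "A i k * B k j = 0" if "i < n" "j < n" "k < n" "block_of ns i \<noteq> block_of ns j" for i j k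
    using assms that by (cases "block_of ns i = block_of ns k") (auto simp: block_unitary_def)
  then have "mmul n A B i j = 0" if "i < n" "j < n" "block_of ns i \<noteq> block_of ns j" for i j
    using that unfolding mmul_def by (simp add: sum.neutral)
  then show ?thesis using assms unitary_mmul unfolding block_unitary_def by blast
qed

lemma block_unitary_adj: "A \<in> block_unitary n ns \<Longrightarrow> madj A \<in> block_unitary n ns"
  by (auto simp: block_unitary_def unitary_adj) (auto simp: madj_def)

lemma block_unitary_conj: "A \<in> block_unitary n ns \<Longrightarrow> mconj A \<in> block_unitary n ns"
  by (auto simp: block_unitary_def unitary_conj) (auto simp: mconj_def)

lemma block_unitary_mid [simp]: "mid n \<in> block_unitary n ns"
  using unitary_mid[of n] unfolding block_unitary_def by (auto simp: mid_def simp del: unitary_mid)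

lemma mvec_mmul: "mvec n (mmul n A B) v = mvec n A (mvec n B v)"
proof
  fix i
  have "(\<Sum>k<n. (\<Sum>m<n. A i m * B m k) * v k) = (\<Sum>m<n. A i m * (\<Sum>k<n. B m k * v k))"
    by (simp add: sum_distrib_left sum_distrib_right mult.assoc) (rule sum.swap)
  then show "mvec n (mmul n A B) v i = mvec n A (mvec n B v) i"
    by (simp add: mvec_def mmul_def)
qed

lemma mvec_mid: "v \<in> cvecs n \<Longrightarrow> mvec n (mid n) v = v"
  by (rule ext) (auto simp: mvec_def mid_def cvecs_def if_distrib[of "\<lambda>x. x * _"] cong: if_cong)

lemma flag_act_mmul: "flag_act n (mmul n A B) F = flag_act n A (flag_act n B F)"
  by (simp add: flag_act_def mvec_mmul image_image)

lemma flag_act_mid: "(\<And>i. F i \<subseteq> cvecs n) \<Longrightarrow> flag_act n (mid n) F = F"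
  unfolding flag_act_def by (intro ext) (metis (no_types, lifting) image_cong image_ident mvec_mid subsetD)

section \<open>Flags as orbits of the coordinate flag\<close>

definition std_flag :: "nat list \<Rightarrow> nat \<Rightarrow> (nat \<Rightarrow> complex) set" where
  "std_flag ms i = (if i \<le> length ms then cvecs (sum_list (take i ms)) else {0})"

lemma sum_list_take_mono: "i \<le> j \<Longrightarrow> sum_list (take i xs) \<le> sum_list (take j (xs :: nat list))"
proof -
  assume "i \<le> j"
  then have "take j xs = take i xs @ take (j - i) (drop i xs)"
    by (metis le_add_diff_inverse take_add)
  then show ?thesis by simp
qed

lemma sum_list_take_le: "sum_list (take i xs) \<le> sum_list (xs :: nat list)"
  using sum_list_take_mono[of i "max i (length xs)" xs] by simp

lemma block_of_eq_iff:
  assumes "i < sum_list ms"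
  shows "block_of ms i = b \<longleftrightarrow> sum_list (take b ms) \<le> i \<and> i < sum_list (take (Suc b) ms)"
proof -
  let ?d = "\<lambda>b. sum_list (take b ms)"
  have ex: "i < ?d (Suc (length ms))" using assms by simp
  have L: "i < ?d (Suc (block_of ms i))" unfolding block_of_def by (rule LeastI[of "\<lambda>b. i < ?d (Suc b)", OF ex])
  have U: "?d (block_of ms i) \<le> i"
  proof (cases "block_of ms i")
    case (Suc c)
    then have "\<not> i < ?d (Suc c)" unfolding block_of_def by (metis lessI not_less_Least)
    then show ?thesis using Suc by simp
  qed simp
  show ?thesis
  proof
    assume *: "?d b \<le> i \<and> i < ?d (Suc b)"
    show "block_of ms i = b"
    proof (rule linorder_cases[of "block_of ms i" b])
      assume "block_of ms i < b"
      then have "?d (Suc (block_of ms i)) \<le> ?d b" by (intro sum_list_take_mono) simp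
      then show ?thesis using * L by simp
    next
      assume "b < block_of ms i"
      then have "?d (Suc b) \<le> ?d (block_of ms i)" by (intro sum_list_take_mono) simp
      then show ?thesis using * U by simp
    qed
  qed (use L U in auto)
qed

lemma block_of_less_length:
  assumes "i < sum_list ms" shows "block_of ms i < length ms"
proof (rule ccontr)
  assume "\<not> block_of ms i < length ms"
  moreover have "sum_list (take (block_of ms i) ms) \<le> i" using block_of_eq_iff[OF assms] by blast
  ultimately show False using assms by simp
qed

lemma block_of_ge_iff:
  assumes "i < sum_list ms"
  shows "b \<le> block_of ms i \<longleftrightarrow> sum_list (take b ms) \<le> i"
proof
  have *: "sum_list (take (block_of ms i) ms) \<le> i" "i < sum_list (take (Suc (block_of ms i)) ms)"
    using block_of_eq_iff[OF assms] by blast+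
  show "sum_list (take b ms) \<le> i" if "b \<le> block_of ms i"
    using sum_list_take_mono[OF that, of ms] * by simp
  show "b \<le> block_of ms i" if "sum_list (take b ms) \<le> i"
  proof (rule ccontr)
    assume "\<not> b \<le> block_of ms i"
    then have "sum_list (take (Suc (block_of ms i)) ms) \<le> sum_list (take b ms)"
      by (intro sum_list_take_mono) simp
    then show False using * that by simp
  qed
qed

lemma mvec_image_subset_iff:
  assumes g: "g \<in> mats n" and d: "d \<le> n"
  shows "mvec n g ` cvecs d \<subseteq> cvecs d \<longleftrightarrow> (\<forall>r<n. \<forall>j<n. j < d \<longrightarrow> d \<le> r \<longrightarrow> g r j = 0)"
proof
  assume L: "mvec n g ` cvecs d \<subseteq> cvecs d"
  show "\<forall>r<n. \<forall>j<n. j < d \<longrightarrow> d \<le> r \<longrightarrow> g r j = 0"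
  proof (intro allI impI)
    fix r j assume *: "r < n" "j < n" "j < d" "d \<le> r"
    define e :: "nat \<Rightarrow> complex" where "e = (\<lambda>i. if i = j then 1 else 0)"
    have "e \<in> cvecs d" using * by (auto simp: cvecs_def e_def)
    then have "mvec n g e r = 0" using L * by (auto simp: cvecs_def)
    moreover have "mvec n g e r = g r j"
      using * by (simp add: mvec_def e_def if_distrib[of "\<lambda>x. _ * x"] cong: if_cong)
    ultimately show "g r j = 0" by simp
  qed
next
  assume R: "\<forall>r<n. \<forall>j<n. j < d \<longrightarrow> d \<le> r \<longrightarrow> g r j = 0"
  have "mvec n g v r = 0" if "v \<in> cvecs d" "d \<le> r" for v r
  proof -
    have "g r j * v j = 0" if "j < n" "r < n" for j
      using R \<open>v \<in> cvecs d\<close> \<open>d \<le> r\<close> that by (cases "j < d") (auto simp: cvecs_def)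
    then show ?thesis by (auto simp: mvec_def intro!: sum.neutral)
  qed
  then show "mvec n g ` cvecs d \<subseteq> cvecs d" by (auto simp: cvecs_def[of d])
qed

lemma cvecs_mono: "d \<le> n \<Longrightarrow> cvecs d \<subseteq> cvecs n"
  by (auto simp: cvecs_def)

lemma mvec_zero: "mvec n g 0 = 0"
  by (auto simp: mvec_def fun_eq_iff)

lemma flag_act_adj_cancel:
  assumes "g \<in> unitary_group n" "\<And>i. F i \<subseteq> cvecs n"
  shows "flag_act n (madj g) (flag_act n g F) = F" "flag_act n g (flag_act n (madj g) F) = F"
  using assms by (simp_all add: flag_act_mmul[symmetric] unitary_adj_left unitary_adj_right flag_act_mid)

lemma std_flag_subset: "sum_list ms = n \<Longrightarrow> std_flag ms i \<subseteq> cvecs n"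
  using cvecs_mono[OF sum_list_take_le[of i ms]] by (auto simp: std_flag_def cvecs_def)

text \<open>Preserving the flag makes a unitary block upper triangular. Its adjoint preserves the
  flag as well, so the entries above the diagonal blocks vanish too.\<close>

lemma std_flag_stabilizer:
  assumes g: "g \<in> unitary_group n" and n: "sum_list ms = n"
  shows "flag_act n g (std_flag ms) = std_flag ms \<longleftrightarrow> g \<in> block_unitary n ms"
proof -
  let ?d = "\<lambda>b. sum_list (take b ms)"
  have dn: "?d b \<le> n" for b using sum_list_take_le[of b ms] n by simp
  have upper: "g i j = 0 "
    if g: "g \<in> unitary_group n" "flag_act n g (std_flag ms) = std_flag ms"
      and ij: "i < n" "j < n" "block_of ms j < block_of ms i" for g i j
  proof -
    let ?b = "Suc (block_of ms j)"
    have "?b \<le> length ms" using block_of_less_length[of j ms] ij n by simp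
    then have "mvec n g ` cvecs (?d ?b) \<subseteq> cvecs (?d ?b)"
      using fun_cong[OF g(2), of ?b] by (simp add: flag_act_def std_flag_def)
    then have *: "\<forall>r<n. \<forall>j<n. j < ?d ?b \<longrightarrow> ?d ?b \<le> r \<longrightarrow> g r j = 0"
      using mvec_image_subset_iff[OF unitary_mats[OF g(1)] dn] by blast
    have "?d ?b \<le> i" using block_of_ge_iff[of i ms ?b] ij n by simp
    moreover have "j < ?d ?b" using block_of_ge_iff[of j ms ?b] ij n by simp
    ultimately show ?thesis using * ij by blast
  qed
  have sub: "flag_act n g (std_flag ms) i \<subseteq> std_flag ms i" if "g \<in> block_unitary n ms" for g i
  proof (cases "i \<le> length ms")
    case True
    have "g r j = 0" if "r < n" "j < n" "j < ?d i" "?d i \<le> r" for r j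
    proof -
      have "i \<le> block_of ms r" "\<not> i \<le> block_of ms j"
        using that n block_of_ge_iff[of r ms i] block_of_ge_iff[of j ms i] by auto
      then show ?thesis using \<open>g \<in> block_unitary n ms\<close> that unfolding block_unitary_def by auto
    qed
    then have "mvec n g ` cvecs (?d i) \<subseteq> cvecs (?d i)"
      using mvec_image_subset_iff[OF unitary_mats[OF block_unitary_unitary[OF that]] dn, of i] by blast
    then show ?thesis using True by (simp add: flag_act_def std_flag_def)
  next
    case False
    then show ?thesis by (simp add: flag_act_def std_flag_def mvec_zero)
  qed
  show ?thesis
  proof
    assume a: "flag_act n g (std_flag ms) = std_flag ms"
    have a': "flag_act n (madj g) (std_flag ms) = std_flag ms"
      using flag_act_adj_cancel(1)[OF g, of "std_flag ms"] std_flag_subset[OF n] a by simp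
    have "g i j = 0" if "i < n" "j < n" "block_of ms i \<noteq> block_of ms j" for i j
    proof (cases "block_of ms j < block_of ms i")
      case True
      then show ?thesis using upper[OF g a] that by blast
    next
      case False
      then have "madj g j i = 0" using upper[OF unitary_adj[OF g] a'] that by auto
      then show ?thesis by (simp add: madj_def)
    qed
    then show "g \<in> block_unitary n ms" using g by (auto simp: block_unitary_def)
  next
    assume a: "g \<in> block_unitary n ms"
    show "flag_act n g (std_flag ms) = std_flag ms"
    proof (rule ext, rule equalityI)
      fix i
      show "flag_act n g (std_flag ms) i \<subseteq> std_flag ms i" using sub[OF a] .
      have "flag_act n g (flag_act n (madj g) (std_flag ms)) i \<subseteq> flag_act n g (std_flag ms) i"
        using sub[OF block_unitary_adj[OF a], of i] by (auto simp: flag_act_def)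
      then show "std_flag ms i \<subseteq> flag_act n g (std_flag ms) i"
        using flag_act_adj_cancel(2)[OF g, of "std_flag ms"] std_flag_subset[OF n] by simp
    qed
  qed
qed

lemma mvec_image_eq_span:
  assumes g: "g \<in> mats n" and d: "d \<le> n"
  shows "mvec n g ` cvecs d = C.span ((\<lambda>r i. g i r) ` {..<d})"
proof
  show "mvec n g ` cvecs d \<subseteq> C.span ((\<lambda>r i. g i r) ` {..<d})"
  proof (rule image_subsetI)
    fix v assume v: "v \<in> cvecs d"
    have "mvec n g v = (\<Sum>r<d. cscale (v r) (\<lambda>i. g i r))"
    proof
      fix i
      have "(\<Sum>j<n. g i j * v j) = (\<Sum>j<d. g i j * v j)"
        using v d by (intro sum.mono_neutral_right) (auto simp: cvecs_def)
      moreover have "g i j = 0" if "\<not> i < n" for j using g that by (auto simp: mats_def)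
      ultimately show "mvec n g v i = (\<Sum>r<d. cscale (v r) (\<lambda>i. g i r)) i"
        by (simp add: mvec_def C.sum_fun_apply cscale_def mult.commute)
    qed
    also have "\<dots> \<in> C.span ((\<lambda>r i. g i r) ` {..<d})"
      by (intro C.span_sum C.span_scale C.span_base) auto
    finally show "mvec n g v \<in> C.span ((\<lambda>r i. g i r) ` {..<d})" .
  qed
  show "C.span ((\<lambda>r i. g i r) ` {..<d}) \<subseteq> mvec n g ` cvecs d"
  proof (rule C.span_minimal)
    show "(\<lambda>r i. g i r) ` {..<d} \<subseteq> mvec n g ` cvecs d"
    proof (rule image_subsetI)
      fix r assume r: "r \<in> {..<d}"
      have "mvec n g (\<lambda>i. if i = r then 1 else 0) = (\<lambda>i. g i r)"
        using r d g by (auto simp: fun_eq_iff mvec_def mats_def if_distrib[of "\<lambda>x. _ * x"] cong: if_cong)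
      moreover have "(\<lambda>i. if i = r then 1 else 0) \<in> cvecs d" using r by (auto simp: cvecs_def)
      ultimately show "(\<lambda>i. g i r) \<in> mvec n g ` cvecs d" by (metis imageI)
    qed
    show "C.subspace (mvec n g ` cvecs d)"
      unfolding C.subspace_def
    proof (intro conjI ballI allI)
      have "(0 :: nat \<Rightarrow> complex) \<in> cvecs d" by (simp add: cvecs_def)
      then show "0 \<in> mvec n g ` cvecs d" using mvec_zero by (metis imageI)
    next
      fix x y assume "x \<in> mvec n g ` cvecs d" "y \<in> mvec n g ` cvecs d"
      then obtain v w where vw: "v \<in> cvecs d" "w \<in> cvecs d" "x = mvec n g v" "y = mvec n g w" by auto
      then have "x + y = mvec n g (v + w)" "v + w \<in> cvecs d"
        by (auto simp: fun_eq_iff mvec_def cvecs_def algebra_simps sum.distrib)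
      then show "x + y \<in> mvec n g ` cvecs d" by auto
    next
      fix c x assume "x \<in> mvec n g ` cvecs d"
      then obtain v where v: "v \<in> cvecs d" "x = mvec n g v" by auto
      then have "cscale c x = mvec n g (cscale c v)" "cscale c v \<in> cvecs d"
        by (auto simp: cscale_def fun_eq_iff mvec_def cvecs_def sum_distrib_left mult_ac)
      then show "cscale c x \<in> mvec n g ` cvecs d" by auto
    qed
  qed
qed

lemma flag_act_std_flag:
  assumes "g \<in> mats n" "sum_list ms = n"
  shows "flag_act n g (std_flag ms) =
    (\<lambda>i. if i \<le> length ms then C.span ((\<lambda>r i. g i r) ` {..<sum_list (take i ms)}) else {0})"
proof
  fix i
  have "sum_list (take i ms) \<le> n" using sum_list_take_le[of i ms] assms(2) by simp
  from mvec_image_eq_span[OF assms(1) this]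
  show "flag_act n g (std_flag ms) i =
    (if i \<le> length ms then C.span ((\<lambda>r i. g i r) ` {..<sum_list (take i ms)}) else {0})"
    by (simp add: flag_act_def std_flag_def mvec_zero)
qed

text \<open>An orthonormal basis adapted to the flag supplies the columns of \<open>g\<close>; this
  is the transitivity of \<open>U(n)\<close> on flags.\<close>

lemma cflags_iff:
  assumes n: "sum_list ms = n"
  shows "F \<in> cflags n ms \<longleftrightarrow> (\<exists>g\<in>unitary_group n. F = flag_act n g (std_flag ms))"
proof
  let ?d = "\<lambda>i. sum_list (take i ms)"
  have dn: "?d i \<le> n" for i using sum_list_take_le[of i ms] n by simp
  {
    assume F: "F \<in> cflags n ms"
    have "C.subspace (F i) \<and> F i \<subseteq> C.vecs n \<and> C.dim (F i) = ?d i" if "i \<le> length ms" for i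
      using F that by (auto simp: cflags_def csubspace_def cvecs_eq cdim_def)
    moreover have "F i \<subseteq> F (Suc i)" if "i < length ms" for i
      using F that by (auto simp: cflags_def)
    ultimately obtain f where f: "C.onf n {..<n} f" "\<forall>i\<le>length ms. F i = C.span (f ` {..<?d i})"
      using C.flag_adapted_basis[of "length ms" F n ?d] dn n by auto
    \<comment> \<open>Outside \<open>{..<n}\<close> the family \<open>f\<close> is arbitrary, hence
      the truncation.\<close>
    define g where "g = (\<lambda>i r. if i < n \<and> r < n then f r i else 0)"
    have gf: "(\<lambda>i. g i r) = f r" if "r < n" for r
      using that f(1) unfolding C.onf_def C.vecs_def g_def by auto
    have gm: "g \<in> mats n" by (auto simp: g_def mats_def)
    have "C.onf n {..<n} (\<lambda>r i. g i r)" using f(1) gf unfolding C.onf_def by simp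
    then have "g \<in> unitary_group n" using gm unitary_iff_onf by blast
    moreover have "F = flag_act n g (std_flag ms)"
    proof
      fix i
      have "(\<lambda>r i. g i r) ` {..<?d i} = f ` {..<?d i}" using gf dn[of i] by (intro image_cong) auto
      then show "F i = flag_act n g (std_flag ms) i"
        using F f(2) unfolding flag_act_std_flag[OF gm n] by (auto simp: cflags_def)
    qed
    ultimately show "\<exists>g\<in>unitary_group n. F = flag_act n g (std_flag ms)" by blast
  }
  assume "\<exists>g\<in>unitary_group n. F = flag_act n g (std_flag ms)"
  then obtain g where g: "g \<in> unitary_group n" and F: "F = flag_act n g (std_flag ms)" by blast
  let ?f = "\<lambda>r i. g i r"
  have o: "C.onf n {..<n} ?f" using g unitary_iff_onf by blast
  have F': "F i = (if i \<le> length ms then C.span (?f ` {..<?d i}) else {0})" for i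
    unfolding F flag_act_std_flag[OF unitary_mats[OF g] n] ..
  have "F i \<subseteq> F (Suc i)" if "i < length ms" for i
  proof -
    have "{..<?d i} \<subseteq> {..<?d (Suc i)}" using sum_list_take_mono[of i "Suc i" ms] by simp
    from C.span_mono[OF image_mono[OF this]] show ?thesis using that by (simp add: F')
  qed
  moreover have "F 0 = {0}" by (simp add: F')
  moreover have "F (length ms) = cvecs n" using C.onf_span_vecs[OF o] n by (simp add: F' cvecs_eq)
  ultimately show "F \<in> cflags n ms"
    using C.onf_span_properties[OF o dn] by (auto simp: cflags_def F' csubspace_def cvecs_eq cdim_def)
qed

text \<open>The inclusion from left to right rests on the fact that the real vectors lying in a
  given complex span form a real subspace.\<close>

lemma complexify_span:
  "complexify (R.span (f ` I)) = C.span ((\<lambda>r i. complex_of_real (f r i)) ` I)"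
proof
  let ?c = "\<lambda>(v::nat \<Rightarrow> real) i. complex_of_real (v i)"
  show "C.span ((\<lambda>r i. complex_of_real (f r i)) ` I) \<subseteq> complexify (R.span (f ` I))"
    unfolding complexify_def by (rule C.span_mono) (auto intro: R.span_base)
  have "R.subspace {v. ?c v \<in> C.span ((\<lambda>r i. complex_of_real (f r i)) ` I)}"
    unfolding R.subspace_def
  proof (intro conjI ballI allI)
    show "0 \<in> {v. ?c v \<in> C.span ((\<lambda>r i. complex_of_real (f r i)) ` I)}"
      using C.span_zero by (simp add: zero_fun_def)
  next
    fix x y assume "x \<in> {v. ?c v \<in> C.span ((\<lambda>r i. complex_of_real (f r i)) ` I)}"
      "y \<in> {v. ?c v \<in> C.span ((\<lambda>r i. complex_of_real (f r i)) ` I)}"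
    then have "?c x + ?c y \<in> C.span ((\<lambda>r i. complex_of_real (f r i)) ` I)"
      by (intro C.span_add) auto
    moreover have "?c x + ?c y = ?c (x + y)" by (auto simp: fun_eq_iff)
    ultimately show "x + y \<in> {v. ?c v \<in> C.span ((\<lambda>r i. complex_of_real (f r i)) ` I)}" by simp
  next
    fix a x assume "x \<in> {v. ?c v \<in> C.span ((\<lambda>r i. complex_of_real (f r i)) ` I)}"
    then have "cscale (complex_of_real a) (?c x) \<in> C.span ((\<lambda>r i. complex_of_real (f r i)) ` I)"
      by (intro C.span_scale) auto
    then show "rscale a x \<in> {v. ?c v \<in> C.span ((\<lambda>r i. complex_of_real (f r i)) ` I)}"
      by (simp add: cscale_def rscale_def)
  qed
  then have "R.span (f ` I) \<subseteq> {v. ?c v \<in> C.span ((\<lambda>r i. complex_of_real (f r i)) ` I)}"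
    by (intro R.span_minimal) (auto intro: C.span_base)
  then show "complexify (R.span (f ` I)) \<subseteq> C.span ((\<lambda>r i. complex_of_real (f r i)) ` I)"
    unfolding complexify_def by (intro C.span_minimal C.subspace_span) auto
qed

lemma orthogonal_of_onf:
  assumes f: "R.onf n {..<n} f"
  shows "(\<lambda>i r. if r < n then complex_of_real (f r i) else 0) \<in> orthogonal_group n"
proof -
  let ?g = "\<lambda>i r. if r < n then complex_of_real (f r i) else 0"
  have "?g i r = 0" if "\<not> (i < n \<and> r < n)" for i r
    using f that unfolding R.onf_def R.vecs_def by auto
  moreover have "(\<Sum>k<n. cnj (?g k i) * ?g k j) = (if i = j then 1 else 0)" if "i < n" "j < n" for i j
  proof -
    have "(\<Sum>k<n. f i k * f j k) = (if i = j then 1 else 0)"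
      using f that unfolding R.onf_def R.ip_def by auto
    moreover have "(\<Sum>k<n. cnj (?g k i) * ?g k j) = complex_of_real (\<Sum>k<n. f i k * f j k)"
      using that by simp
    ultimately show ?thesis by (metis of_real_0 of_real_1)
  qed
  ultimately show ?thesis by (auto simp: orthogonal_group_def unitary_group_def)
qed

lemma onf_of_orthogonal:
  assumes g: "g \<in> orthogonal_group n"
  shows "R.onf n {..<n} (\<lambda>r i. Re (g i r))" "\<And>i j. complex_of_real (Re (g i j)) = g i j"
proof -
  show re: "complex_of_real (Re (g i j)) = g i j" for i j
    using g by (simp add: orthogonal_group_def of_real_Re)
  have "(\<Sum>k<n. Re (g k i) * Re (g k j)) = (if i = j then 1 else 0)" if "i < n" "j < n" for i j
  proof -
    have "complex_of_real (\<Sum>k<n. Re (g k i) * Re (g k j)) = (\<Sum>k<n. cnj (g k i) * g k j)"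
      unfolding of_real_sum of_real_mult by (intro sum.cong refl) (metis complex_cnj_complex_of_real re)
    also have "\<dots> = (if i = j then 1 else 0)"
      using g that by (auto simp: orthogonal_group_def unitary_group_def)
    finally show ?thesis by (metis of_real_eq_iff of_real_0 of_real_1)
  qed
  moreover have "g i r = 0" if "\<not> i < n" for i r
    using g that by (auto simp: orthogonal_group_def unitary_group_def)
  ultimately show "R.onf n {..<n} (\<lambda>r i. Re (g i r))"
    unfolding R.onf_def R.vecs_def R.ip_def by auto
qed

lemma complexify_zero: "complexify {0} = {0}"
  using complexify_span[of "\<lambda>_. 0" "{}"] by simp

text \<open>Real counterpart of \<open>cflags_iff\<close>: a real orthonormal basis adapted to the
  real flag gives the columns of \<open>g\<close>. From here on, real flags are handled through
  orthogonal matrices.\<close>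

lemma complexify_rflags_iff:
  assumes n: "sum_list ms = n"
  shows "(\<exists>W\<in>rflags n ms. F = complexify_flag W) \<longleftrightarrow> (\<exists>g\<in>orthogonal_group n. F = flag_act n g (std_flag ms))"
proof
  let ?d = "\<lambda>i. sum_list (take i ms)"
  have dn: "?d i \<le> n" for i using sum_list_take_le[of i ms] n by simp
  {
    assume "\<exists>W\<in>rflags n ms. F = complexify_flag W"
    then obtain W where W: "W \<in> rflags n ms" and F: "F = complexify_flag W" by blast
    have "R.subspace (W i) \<and> W i \<subseteq> R.vecs n \<and> R.dim (W i) = ?d i" if "i \<le> length ms" for i
      using W that by (auto simp: rflags_def rsubspace_def rvecs_eq rdim_def)
    moreover have "W i \<subseteq> W (Suc i)" if "i < length ms" for i
      using W that by (auto simp: rflags_def)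
    ultimately obtain f where f: "R.onf n {..<n} f" "\<forall>i\<le>length ms. W i = R.span (f ` {..<?d i})"
      using R.flag_adapted_basis[of "length ms" W n ?d] dn n by auto
    define g where "g = (\<lambda>i r. if r < n then complex_of_real (f r i) else 0)"
    have g: "g \<in> orthogonal_group n" unfolding g_def by (rule orthogonal_of_onf[OF f(1)])
    have "F = flag_act n g (std_flag ms)"
    proof
      fix i
      have "(\<lambda>r i. g i r) ` {..<?d i} = (\<lambda>r i. complex_of_real (f r i)) ` {..<?d i}"
        using dn[of i] by (intro image_cong) (auto simp: g_def)
      moreover have "W i = {0}" if "i > length ms" using W that by (simp add: rflags_def)
      ultimately show "F i = flag_act n g (std_flag ms) i"
        using f(2) unfolding flag_act_std_flag[OF unitary_mats[OF orthogonal_unitary[OF g]] n] F complexify_flag_def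
        by (simp add: complexify_span complexify_zero)
    qed
    then show "\<exists>g\<in>orthogonal_group n. F = flag_act n g (std_flag ms)" using g by blast
  }
  assume "\<exists>g\<in>orthogonal_group n. F = flag_act n g (std_flag ms)"
  then obtain g where g: "g \<in> orthogonal_group n" and F: "F = flag_act n g (std_flag ms)" by blast
  let ?f = "\<lambda>r i. Re (g i r)"
  note o = onf_of_orthogonal(1)[OF g]
  define W where "W = (\<lambda>i. if i \<le> length ms then R.span (?f ` {..<?d i}) else {0})"
  have "W i \<subseteq> W (Suc i)" if "i < length ms" for i
  proof -
    have "{..<?d i} \<subseteq> {..<?d (Suc i)}" using sum_list_take_mono[of i "Suc i" ms] by simp
    from R.span_mono[OF image_mono[OF this]] show ?thesis using that by (simp add: W_def)
  qed
  moreover have "W 0 = {0}" by (simp add: W_def)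
  moreover have "W (length ms) = rvecs n" using R.onf_span_vecs[OF o] n by (simp add: W_def rvecs_eq)
  ultimately have "W \<in> rflags n ms"
    using R.onf_span_properties[OF o dn] by (auto simp: rflags_def W_def rsubspace_def rvecs_eq rdim_def)
  moreover have "F = complexify_flag W"
    unfolding F flag_act_std_flag[OF unitary_mats[OF orthogonal_unitary[OF g]] n] complexify_flag_def W_def
    by (intro ext) (simp add: complexify_span onf_of_orthogonal(2)[OF g] complexify_zero)
  ultimately show "\<exists>W\<in>rflags n ms. F = complexify_flag W" by blast
qed

section \<open>Equivalence of the group and flag conditions\<close>

definition triple_product :: "nat \<Rightarrow> nat list \<Rightarrow> nat list \<Rightarrow> bool" where
  "triple_product n ns ms \<longleftrightarrow> (\<forall>g\<in>unitary_group n. \<exists>x\<in>block_unitary n ns.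
     \<exists>g'\<in>orthogonal_group n. \<exists>h\<in>block_unitary n ms. g = mmul n x (mmul n g' h))"

text \<open>Adjoints reverse the order of the factors and preserve each of the three
  subgroups.\<close>

lemma triple_product_commute_imp:
  assumes "triple_product n ns ms" shows "triple_product n ms ns"
  unfolding triple_product_def
proof
  fix g assume "g \<in> unitary_group n"
  then have "madj g \<in> unitary_group n" by (rule unitary_adj)
  then obtain x r h where *: "x \<in> block_unitary n ns" "r \<in> orthogonal_group n" "h \<in> block_unitary n ms"
    "madj g = mmul n x (mmul n r h)" using assms unfolding triple_product_def by blast
  have "g = madj (madj g)" by simp
  also have "\<dots> = mmul n (madj h) (mmul n (madj r) (madj x))" unfolding *(4) by (simp add: madj_mmul mmul_assoc)
  finally show "\<exists>x\<in>block_unitary n ms. \<exists>g'\<in>orthogonal_group n. \<exists>h\<in>block_unitary n ns. g = mmul n x (mmul n g' h)"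
    using *(1-3) by (blast intro: block_unitary_adj orthogonal_adj)
qed

lemma triple_product_commute: "triple_product n ns ms \<longleftrightarrow> triple_product n ms ns"
  using triple_product_commute_imp by blast

lemma same_flag_imp_block:
  assumes "g \<in> unitary_group n" "h \<in> unitary_group n" "sum_list ms = n"
    and "flag_act n g (std_flag ms) = flag_act n h (std_flag ms)"
  shows "mmul n (madj h) g \<in> block_unitary n ms"
proof -
  have "flag_act n (mmul n (madj h) g) (std_flag ms) = std_flag ms"
    using assms flag_act_adj_cancel(1)[OF assms(2), of "std_flag ms"] std_flag_subset[OF assms(3)] by (simp add: flag_act_mmul)
  then show ?thesis using std_flag_stabilizer assms unitary_mmul unitary_adj by metis
qed

text \<open>Write \<open>F\<close> as the image of the coordinate flag \<open>?E\<close> under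
  \<open>g\<close>. Then \<open>x\<close> moves \<open>F\<close> to a real flag exactly when
  \<open>x g\<close> and some orthogonal \<open>r\<close> send \<open>?E\<close> to the same flag;
  in that case \<open>madj r\<close> times \<open>x g\<close> stabilises \<open>?E\<close> and is
  the factor in \<open>H\<close>.\<close>

lemma triple_product_iff_flags:
  assumes n: "sum_list ns = n" "sum_list ms = n"
  shows "triple_product n ns ms \<longleftrightarrow>
    (\<forall>F\<in>cflags n ms. \<exists>x\<in>block_unitary n ns. \<exists>W\<in>rflags n ms. flag_act n x F = complexify_flag W)"
    (is "_ \<longleftrightarrow> ?R")
proof
  let ?E = "std_flag ms"
  assume T: "triple_product n ns ms"
  show ?R
  proof
    fix F assume "F \<in> cflags n ms"
    then obtain g where g: "g \<in> unitary_group n" and F: "F = flag_act n g ?E" using cflags_iff[OF n(2)] by blast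
    then obtain x r h where *: "x \<in> block_unitary n ns" "r \<in> orthogonal_group n" "h \<in> block_unitary n ms"
      "g = mmul n x (mmul n r h)" using T unfolding triple_product_def by blast
    have "mmul n (madj x) g = mmul n r h"
      unfolding *(4) by (rule unitary_cancel_left[OF block_unitary_unitary[OF *(1)]]) simp
    then have "flag_act n (madj x) F = flag_act n r (flag_act n h ?E)"
      unfolding F flag_act_mmul[symmetric] by simp
    also have "flag_act n h ?E = ?E"
      using std_flag_stabilizer[OF block_unitary_unitary[OF *(3)] n(2)] *(3) by blast
    finally have "\<exists>W\<in>rflags n ms. flag_act n (madj x) F = complexify_flag W"
      using complexify_rflags_iff[OF n(2)] *(2) by blast
    then show "\<exists>x\<in>block_unitary n ns. \<exists>W\<in>rflags n ms. flag_act n x F = complexify_flag W"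
      using block_unitary_adj[OF *(1)] by blast
  qed
next
  let ?E = "std_flag ms"
  assume R: ?R
  show "triple_product n ns ms" unfolding triple_product_def
  proof
    fix g assume g: "g \<in> unitary_group n"
    then have "flag_act n g ?E \<in> cflags n ms" using cflags_iff[OF n(2)] by blast
    then obtain x where x: "x \<in> block_unitary n ns" "\<exists>W\<in>rflags n ms. flag_act n x (flag_act n g ?E) = complexify_flag W"
      using R by blast
    then obtain r where r: "r \<in> orthogonal_group n" "flag_act n (mmul n x g) ?E = flag_act n r ?E"
      using complexify_rflags_iff[OF n(2)] unfolding flag_act_mmul by metis
    note xu = block_unitary_unitary[OF x(1)] and ru = orthogonal_unitary[OF r(1)]
    have h: "mmul n (madj r) (mmul n x g) \<in> block_unitary n ms"
      by (rule same_flag_imp_block[OF unitary_mmul[OF xu g] ru n(2) r(2)])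
    have "g = mmul n (madj x) (mmul n r (mmul n (madj r) (mmul n x g)))"
      using unitary_cancel_left'[OF ru] unitary_cancel_left[OF xu] unitary_mats[OF g] by simp
    then show "\<exists>x\<in>block_unitary n ns. \<exists>g'\<in>orthogonal_group n. \<exists>h\<in>block_unitary n ms. g = mmul n x (mmul n g' h)"
      using block_unitary_adj[OF x(1)] r(1) h by blast
  qed
qed

text \<open>For flags given by \<open>g1\<close> and \<open>g2\<close> the factorisation is applied
  to their relative position \<open>mmul n (madj g2) g1\<close>; conversely, the pair of flags given
  by \<open>g\<close> and \<open>mid n\<close> recovers the factorisation of
  \<open>g\<close>.\<close>

lemma triple_product_iff_flag_pairs:
  assumes n: "sum_list ns = n" "sum_list ms = n"
  shows "triple_product n ns ms \<longleftrightarrow>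
    (\<forall>F1\<in>cflags n ms. \<forall>F2\<in>cflags n ns. \<exists>g\<in>unitary_group n. \<exists>W1\<in>rflags n ms. \<exists>W2\<in>rflags n ns.
            flag_act n g F1 = complexify_flag W1 \<and> flag_act n g F2 = complexify_flag W2)"
    (is "_ \<longleftrightarrow> ?R")
proof
  assume T: "triple_product n ns ms"
  show ?R
  proof (intro ballI)
    fix F1 F2 assume "F1 \<in> cflags n ms" "F2 \<in> cflags n ns"
    then obtain g1 g2 where g: "g1 \<in> unitary_group n" "g2 \<in> unitary_group n"
      and F: "F1 = flag_act n g1 (std_flag ms)" "F2 = flag_act n g2 (std_flag ns)"
      using cflags_iff n by blast
    have "mmul n (madj g2) g1 \<in> unitary_group n" using g by (simp add: unitary_mmul unitary_adj)
    then obtain x r h where *: "x \<in> block_unitary n ns" "r \<in> orthogonal_group n" "h \<in> block_unitary n ms"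
      "mmul n (madj g2) g1 = mmul n x (mmul n r h)" using T unfolding triple_product_def by blast
    let ?u = "mmul n (madj x) (madj g2)"
    note xu = block_unitary_unitary[OF *(1)]
    have u: "?u \<in> unitary_group n" using g xu by (simp add: unitary_mmul unitary_adj)
    have "mmul n ?u g1 = mmul n r h"
      unfolding mmul_assoc *(4) by (rule unitary_cancel_left[OF xu]) simp
    then have "flag_act n ?u F1 = flag_act n r (flag_act n h (std_flag ms))"
      unfolding F flag_act_mmul[symmetric] by simp
    also have "flag_act n h (std_flag ms) = std_flag ms"
      using std_flag_stabilizer[OF block_unitary_unitary[OF *(3)] n(2)] *(3) by blast
    finally have 1: "\<exists>W\<in>rflags n ms. flag_act n ?u F1 = complexify_flag W"
      using complexify_rflags_iff[OF n(2)] *(2) by blast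
    have "mmul n ?u g2 = madj x"
      unfolding mmul_assoc unitary_adj_left[OF g(2)] using unitary_mats[OF xu] by simp
    then have "flag_act n ?u F2 = flag_act n (madj x) (std_flag ns)"
      unfolding F flag_act_mmul[symmetric] by simp
    also have "\<dots> = std_flag ns"
      using std_flag_stabilizer[OF unitary_adj[OF xu] n(1)] block_unitary_adj[OF *(1)] by blast
    also have "\<dots> = flag_act n (mid n) (std_flag ns)"
      using flag_act_mid[of "std_flag ns" n] std_flag_subset[OF n(1)] by simp
    finally have "\<exists>W\<in>rflags n ns. flag_act n ?u F2 = complexify_flag W"
      using complexify_rflags_iff[OF n(1)] orthogonal_mid by blast
    then show "\<exists>g\<in>unitary_group n. \<exists>W1\<in>rflags n ms. \<exists>W2\<in>rflags n ns.
            flag_act n g F1 = complexify_flag W1 \<and> flag_act n g F2 = complexify_flag W2"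
      using 1 u by blast
  qed
next
  assume R: ?R
  show "triple_product n ns ms" unfolding triple_product_def
  proof
    fix g assume g: "g \<in> unitary_group n"
    have "flag_act n g (std_flag ms) \<in> cflags n ms" using g cflags_iff[OF n(2)] by blast
    moreover have "flag_act n (mid n) (std_flag ns) \<in> cflags n ns" using cflags_iff[OF n(1)] unitary_mid by blast
    ultimately obtain u where u: "u \<in> unitary_group n"
      "\<exists>W\<in>rflags n ms. flag_act n (mmul n u g) (std_flag ms) = complexify_flag W"
      "\<exists>W\<in>rflags n ns. flag_act n (mmul n u (mid n)) (std_flag ns) = complexify_flag W"
      using R unfolding flag_act_mmul by metis
    obtain r1 where r1: "r1 \<in> orthogonal_group n" "flag_act n (mmul n u g) (std_flag ms) = flag_act n r1 (std_flag ms)"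
      using u(2) complexify_rflags_iff[OF n(2)] by metis
    obtain r2 where r2: "r2 \<in> orthogonal_group n" "flag_act n u (std_flag ns) = flag_act n r2 (std_flag ns)"
      using u(3) complexify_rflags_iff[OF n(1)] mmul_mid_right[OF unitary_mats[OF u(1)]] by metis
    note ru = orthogonal_unitary[OF r1(1)] orthogonal_unitary[OF r2(1)]
    let ?h = "mmul n (madj r1) (mmul n u g)" and ?y = "mmul n (madj r2) u"
    have h: "?h \<in> block_unitary n ms"
      by (rule same_flag_imp_block[OF unitary_mmul[OF u(1) g] ru(1) n(2) r1(2)])
    have y: "?y \<in> block_unitary n ns"
      by (rule same_flag_imp_block[OF u(1) ru(2) n(1) r2(2)])
    have "mmul n (madj ?y) (mmul n (mmul n (madj r2) r1) ?h) = g"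
      using unitary_cancel_left'[OF ru(1)] unitary_cancel_left'[OF ru(2)] unitary_cancel_left[OF u(1)] unitary_mats[OF g]
      by (simp add: madj_mmul mmul_assoc)
    then show "\<exists>x\<in>block_unitary n ns. \<exists>g'\<in>orthogonal_group n. \<exists>h\<in>block_unitary n ms. g = mmul n x (mmul n g' h)"
      using block_unitary_adj[OF y] orthogonal_mmul[OF orthogonal_adj[OF r2(1)] r1(1)] h by metis
  qed
qed

subsection \<open>Gram matrices and sufficiency\<close>

definition block :: "nat list \<Rightarrow> nat \<Rightarrow> nat set" where
  "block ns a = {i. i < sum_list ns \<and> block_of ns i = a}"

text \<open>A copy of the unitary group of the coordinates in \<open>S\<close>, extended by the
  identity. It allows one block to be changed without touching the others.\<close>

definition usub :: "nat \<Rightarrow> nat set \<Rightarrow> (nat \<Rightarrow> nat \<Rightarrow> complex) set" where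
  "usub n S = {A \<in> unitary_group n. \<forall>i j. i \<notin> S \<or> j \<notin> S \<longrightarrow> A i j = mid n i j}"

definition row_mask :: "nat set \<Rightarrow> (nat \<Rightarrow> nat \<Rightarrow> complex) \<Rightarrow> nat \<Rightarrow> nat \<Rightarrow> complex" where
  "row_mask S g = (\<lambda>i j. if i \<in> S then g i j else 0)"

text \<open>A matrix product rather than a table of sums, so that right multiplication becomes
  conjugation (\<open>gram_mmul_right\<close>). The restriction to the columns of one block is
  imposed only where it is used.\<close>

definition gram :: "nat \<Rightarrow> nat set \<Rightarrow> (nat \<Rightarrow> nat \<Rightarrow> complex) \<Rightarrow> nat \<Rightarrow> nat \<Rightarrow> complex" where
  "gram n S g = mmul n (madj (row_mask S g)) (row_mask S g)"

lemma usub_unitary: "A \<in> usub n S \<Longrightarrow> A \<in> unitary_group n"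
  by (simp add: usub_def)

lemma usub_mid [simp]: "mid n \<in> usub n S"
  by (simp add: usub_def)

lemma usub_mono: "S \<subseteq> T \<Longrightarrow> usub n S \<subseteq> usub n T"
  by (auto simp: usub_def)

lemma usub_row: assumes "A \<in> usub n S" "i \<notin> S" "B \<in> mats n" shows "mmul n A B i j = B i j"
proof -
  have "mmul n A B i j = mmul n (mid n) B i j" using assms by (simp add: usub_def mmul_def)
  then show ?thesis using assms by simp
qed

lemma usub_col: assumes "A \<in> usub n S" "j \<notin> S" "B \<in> mats n" shows "mmul n B A i j = B i j"
proof -
  have "mmul n B A i j = mmul n B (mid n) i j" using assms by (simp add: usub_def mmul_def)
  then show ?thesis using assms by simp
qed

lemma usub_mmul:
  assumes "A \<in> usub n S" "B \<in> usub n S" shows "mmul n A B \<in> usub n S"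
proof -
  have m: "A \<in> mats n" "B \<in> mats n" using assms usub_unitary unitary_mats by blast+
  have "mmul n A B i j = mid n i j" if "i \<notin> S \<or> j \<notin> S" for i j
    using that usub_row[OF assms(1) _ m(2), of i j] usub_col[OF assms(2) _ m(1), of j i] assms
    unfolding usub_def by auto
  then show ?thesis using assms unitary_mmul unfolding usub_def by blast
qed

lemma usub_adj: assumes "A \<in> usub n S" shows "madj A \<in> usub n S"
proof -
  have "madj A i j = mid n i j" if "i \<notin> S \<or> j \<notin> S" for i j
  proof -
    have "A j i = mid n j i" using assms that unfolding usub_def by blast
    then show ?thesis by (simp add: madj_def mid_def)
  qed
  then show ?thesis using assms unitary_adj unfolding usub_def by blast
qed

lemma usub_block: 
  assumes "A \<in> usub n S" "S \<subseteq> block ns a" shows "A \<in> block_unitary n ns"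
proof -
  have "A i j = 0" if "block_of ns i \<noteq> block_of ns j" for i j
  proof -
    have "i \<notin> S \<or> j \<notin> S" using that assms(2) by (auto simp: block_def)
    then have "A i j = mid n i j" using assms(1) by (auto simp: usub_def)
    then show ?thesis using that by (auto simp: mid_def)
  qed
  then show ?thesis using assms(1) by (simp add: block_unitary_def usub_def)
qed

lemma row_mask_mats [simp]: "g \<in> mats n \<Longrightarrow> row_mask S g \<in> mats n"
  by (auto simp: row_mask_def mats_def)

lemma row_mask_mmul_right: "row_mask S (mmul n g h) = mmul n (row_mask S g) h"
  by (intro ext) (auto simp: row_mask_def mmul_def)

lemma row_mask_mmul_left:
  assumes "\<And>i k. i < n \<Longrightarrow> k < n \<Longrightarrow> (i \<in> S) \<noteq> (k \<in> S) \<Longrightarrow> y i k = 0"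
  shows "row_mask S (mmul n y g) = mmul n y (row_mask S g)"
proof (intro ext)
  fix i j
  have "(if i \<in> S then y i k * g k j else 0) = y i k * (if k \<in> S then g k j else 0)" if "i < n" "k < n" for k
    using assms[OF that] by auto
  then have "(\<Sum>k<n. if i \<in> S then y i k * g k j else 0) = (\<Sum>k<n. y i k * (if k \<in> S then g k j else 0))" if "i < n"
    using that by (intro sum.cong) auto
  then show "row_mask S (mmul n y g) i j = mmul n y (row_mask S g) i j"
    by (auto simp: row_mask_def mmul_def)
qed

lemma gram_apply:
  assumes "S \<subseteq> {..<n}" "j < n" "k < n"
  shows "gram n S g j k = (\<Sum>i\<in>S. cnj (g i j) * g i k)"
proof -
  have "(\<Sum>i<n. cnj (row_mask S g i j) * row_mask S g i k) = (\<Sum>i\<in>S. cnj (row_mask S g i j) * row_mask S g i k)"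
    using assms by (intro sum.mono_neutral_right) (auto simp: row_mask_def)
  also have "\<dots> = (\<Sum>i\<in>S. cnj (g i j) * g i k)"
    by (intro sum.cong) (auto simp: row_mask_def)
  finally show ?thesis using assms by (simp add: gram_def mmul_def madj_def)
qed

lemma gram_mmul_right:
  "gram n S (mmul n g h) = mmul n (madj h) (mmul n (gram n S g) h)"
  by (simp add: gram_def row_mask_mmul_right madj_mmul mmul_assoc)

text \<open>A unitary that does not mix the rows in \<open>S\<close> with the others commutes with
  the mask, and unitaries preserve inner products of columns.\<close>

lemma gram_mmul_left:
  assumes "y \<in> unitary_group n" "g \<in> mats n"
    and "\<And>i k. i < n \<Longrightarrow> k < n \<Longrightarrow> (i \<in> S) \<noteq> (k \<in> S) \<Longrightarrow> y i k = 0"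
  shows "gram n S (mmul n y g) = gram n S g"
proof -
  have "row_mask S (mmul n y g) = mmul n y (row_mask S g)"
    using assms(3) by (rule row_mask_mmul_left)
  then have "gram n S (mmul n y g) = mmul n (madj (mmul n y (row_mask S g))) (mmul n y (row_mask S g))"
    by (simp add: gram_def)
  also have "\<dots> = gram n S g"
    using unitary_cancel_left[OF assms(1), of "row_mask S g"] assms(2)
    by (simp add: madj_mmul mmul_assoc gram_def)
  finally show ?thesis .
qed

lemma gram_usub:
  assumes "y \<in> usub n S" "g \<in> mats n"
  shows "gram n S (mmul n y g) = gram n S g"
  using assms by (intro gram_mmul_left) (auto simp: usub_def mid_def)

lemma gram_block:
  assumes "y \<in> block_unitary n ns" "g \<in> mats n" "sum_list ns = n"
  shows "gram n (block ns a) (mmul n y g) = gram n (block ns a) g"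
  using assms by (intro gram_mmul_left) (auto simp: block_unitary_def block_def)

lemma gram_adj: "madj (gram n S g) = gram n S g"
  by (simp add: gram_def madj_mmul)

lemma gram_hermitian: "gram n S g k j = cnj (gram n S g j k)"
  using fun_cong[OF fun_cong[OF gram_adj[of n S g]], of k j] by (simp add: madj_def)

lemma gram_diag_real: "gram n S g j j \<in> \<real>"
  using gram_hermitian[of n S g j j] by (simp add: Reals_cnj_iff)

lemma block_subset: "sum_list ns = n \<Longrightarrow> block ns a \<subseteq> {..<n}"
  by (auto simp: block_def)

lemma finite_block [simp]: "finite (block ns a)"
  by (simp add: block_def)

lemma sum_over_blocks:
  assumes "sum_list ns = n"
  shows "(\<Sum>a<length ns. \<Sum>i\<in>block ns a. f i) = (\<Sum>i<n. f i)"
proof -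
  have "(\<Sum>i<n. f i) = (\<Sum>a<length ns. \<Sum>i\<in>{i\<in>{..<n}. block_of ns i = a}. f i)"
    using assms block_of_less_length by (intro sum.group[symmetric]) auto
  also have "\<dots> = (\<Sum>a<length ns. \<Sum>i\<in>block ns a. f i)"
    using assms by (intro sum.cong refl) (auto simp: block_def)
  finally show ?thesis by simp
qed

lemma sum_gram_blocks:
  assumes "g \<in> unitary_group n" "sum_list ns = n" "j < n" "k < n"
  shows "(\<Sum>a<length ns. gram n (block ns a) g j k) = (if j = k then 1 else 0)"
proof -
  have "(\<Sum>a<length ns. gram n (block ns a) g j k) = (\<Sum>i<n. cnj (g i j) * g i k)"
    using assms by (simp add: gram_apply block_subset sum_over_blocks)
  also have "\<dots> = (if j = k then 1 else 0)" using assms by (auto simp: unitary_group_def)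
  finally show ?thesis .
qed

section \<open>Diagonalisation and real rows by unitary changes of coordinates\<close>

lemma exists_usub_column:
  assumes S: "S \<subseteq> {..<n}" "s \<in> S" and v: "(\<Sum>i\<in>S. cnj (v i) * v i) = 1"
  shows "\<exists>x\<in>usub n S. \<forall>i\<in>S. x i s = v i"
proof -
  define w where "w = (\<lambda>i. if i \<in> S then v i else 0)"
  \<comment> \<open>The unit vectors outside \<open>S\<close> are prescribed together with
    \<open>w\<close>, so orthogonality forces every further vector of the completion to be supported
    in \<open>S\<close>.\<close>
  let ?I = "insert s ({..<n} - S)"
  have w1: "C.ip n w w = 1"
  proof -
    have "C.ip n w w = (\<Sum>i\<in>S. cnj (w i) * w i)"
      unfolding C.ip_def using S by (intro sum.mono_neutral_right) (auto simp: w_def)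
    also have "\<dots> = (\<Sum>i\<in>S. cnj (v i) * v i)" by (intro sum.cong) (auto simp: w_def)
    finally show ?thesis using v by simp
  qed
  have wv: "w \<in> C.vecs n" using S by (auto simp: C.vecs_def w_def)
  have wu: "C.ip n (C.unit_vec r) w = 0" if "r \<notin> S" for r
    using that by (auto simp: C.ip_def C.unit_vec_def w_def intro!: sum.neutral)
  have "C.onf n ({..<n} - S) C.unit_vec"
    using C.onf_subset[OF C.onf_unit_vec, of "{..<n} - S"] by auto
  then have "C.onf n ?I (C.unit_vec(s := w))"
    using S wv w1 wu by (intro C.onf_insert) auto
  then obtain f where f: "C.onf n {..<n} f" "\<forall>i\<in>?I. f i = (C.unit_vec(s := w)) i"
    using C.onf_extend[of ?I n "C.unit_vec(s := w)"] S by blast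
  define x where "x = (\<lambda>i r. if r < n then f r i else 0)"
  have fv: "f r i = 0" if "r < n" "\<not> i < n" for r i
    using f(1) that unfolding C.onf_def C.vecs_def by auto
  have xm: "x \<in> mats n" using fv by (auto simp: x_def mats_def)
  have "C.onf n {..<n} (\<lambda>r i. x i r)" using f(1) unfolding C.onf_def x_def by simp
  then have xu: "x \<in> unitary_group n" using xm unitary_iff_onf by blast
  have fu: "f r = C.unit_vec r" if "r < n" "r \<notin> S" for r using f(2) that S by auto
  have "x i j = mid n i j" if ij: "i \<notin> S \<or> j \<notin> S" for i j
  proof (cases "i < n \<and> j < n")
    case False
    then show ?thesis using xm by (auto simp: mats_def mid_def)
  next
    case ltn: True
    show ?thesis
    proof (cases "j \<in> S")
      case False
      then show ?thesis using fu[of j] ltn by (auto simp: x_def mid_def C.unit_vec_def)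
    next
      case True
      then have i: "i \<notin> S" using ij by simp
      have "C.ip n (f i) (f j) = (if i = j then 1 else 0)" using f(1) ltn unfolding C.onf_def by auto
      moreover have "C.ip n (f i) (f j) = f j i"
        using fu[of i] i ltn by (simp add: C.ip_def C.unit_vec_def if_distrib[of cnj] if_distrib[of "\<lambda>x. x * _"] cong: if_cong)
      ultimately show ?thesis using ltn by (simp add: x_def mid_def)
    qed
  qed
  then have "x \<in> usub n S" using xu by (auto simp: usub_def)
  moreover have "\<forall>i\<in>S. x i s = v i" using f(2) S by (auto simp: x_def w_def)
  ultimately show ?thesis by blast
qed

text \<open>The factor is real so that multiples of real Gram entries by it stay real.\<close>

lemma normalize_on:
  assumes "finite S" "i \<in> S" "v i \<noteq> (0::complex)"
  obtains c :: real where "c > 0" "(\<Sum>i\<in>S. cnj (complex_of_real c * v i) * (complex_of_real c * v i)) = 1"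
proof -
  define s where "s = (\<Sum>i\<in>S. (norm (v i))\<^sup>2)"
  have s: "s > 0" unfolding s_def using assms by (intro sum_pos2[of _ i]) auto
  have *: "cnj z * z = complex_of_real ((norm z)\<^sup>2)" for z
    using complex_norm_square[of z] by (simp add: mult.commute)
  have "(\<Sum>i\<in>S. cnj (complex_of_real (1 / sqrt s) * v i) * (complex_of_real (1 / sqrt s) * v i)) =
    complex_of_real (\<Sum>i\<in>S. (norm (complex_of_real (1 / sqrt s) * v i))\<^sup>2)"
    unfolding * by simp
  also have "(\<Sum>i\<in>S. (norm (complex_of_real (1 / sqrt s) * v i))\<^sup>2) = (\<Sum>i\<in>S. (norm (v i))\<^sup>2 / s)"
    using s by (intro sum.cong) (simp_all add: norm_mult norm_divide power_divide power_mult_distrib)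
  also have "\<dots> = s / s" by (simp add: s_def flip: sum_divide_distrib)
  finally have "(\<Sum>i\<in>S. cnj (complex_of_real (1 / sqrt s) * v i) * (complex_of_real (1 / sqrt s) * v i)) = 1"
    using s by simp
  then show thesis using that[of "1 / sqrt s"] s by simp
qed

text \<open>Induction on the rows: \<open>madj x0\<close> sends a nonzero column, cut to
  \<open>S\<close>, to a positive multiple of the unit vector at \<open>s\<close>, and row
  \<open>s\<close> then consists of real multiples of Gram entries. Subtracting its real rank-one
  contribution leaves a real Gram matrix for the other rows.\<close>

lemma real_gram_imp_real_rows:
  assumes "finite S" "S \<subseteq> {..<n}" "J \<subseteq> {..<n}" "g \<in> mats n"
    and "\<And>j k. j \<in> J \<Longrightarrow> k \<in> J \<Longrightarrow> gram n S g j k \<in> \<real>"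
  shows "\<exists>x\<in>usub n S. \<forall>i\<in>S. \<forall>j\<in>J. mmul n x g i j \<in> \<real>"
  using assms
proof (induction "card S" arbitrary: S g)
  case 0
  then show ?case by (intro bexI[of _ "mid n"]) auto
next
  case (Suc m)
  show ?case
  proof (cases "\<forall>i\<in>S. \<forall>j\<in>J. g i j = 0")
    case True
    then show ?thesis using Suc.prems(4) by (intro bexI[of _ "mid n"]) auto
  next
    case False
    then obtain s j0 where s: "s \<in> S" "j0 \<in> J" "g s j0 \<noteq> 0" by blast
    obtain c where c: "c > 0" "(\<Sum>i\<in>S. cnj (complex_of_real c * g i j0) * (complex_of_real c * g i j0)) = 1"
      using normalize_on[of S s "\<lambda>i. g i j0"] Suc.prems(1) s by blast
    obtain x0 where x0: "x0 \<in> usub n S" "\<forall>i\<in>S. x0 i s = complex_of_real c * g i j0"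
      using exists_usub_column[OF Suc.prems(2) s(1) c(2)] by blast
    let ?g = "mmul n (madj x0) g"
    have x0z: "x0 i s = 0" if "i \<notin> S" for i using x0(1) that s by (auto simp: usub_def mid_def)
    have sn: "s < n" and jn: "j0 < n" using s Suc.prems by auto
    have row: "?g s j \<in> \<real>" if "j \<in> J" for j
    proof -
      have jn: "j < n" using that Suc.prems by auto
      have "?g s j = (\<Sum>i<n. cnj (x0 i s) * g i j)" using sn jn by (simp add: mmul_def madj_def)
      also have "\<dots> = (\<Sum>i\<in>S. cnj (x0 i s) * g i j)"
        using x0z Suc.prems by (intro sum.mono_neutral_right) auto
      also have "\<dots> = (\<Sum>i\<in>S. complex_of_real c * (cnj (g i j0) * g i j))"
        using x0(2) by (intro sum.cong) auto
      also have "\<dots> = complex_of_real c * gram n S g j0 j"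
        using Suc.prems jn \<open>j0 < n\<close> by (simp add: gram_apply sum_distrib_left)
      finally show ?thesis using Suc.prems(5)[OF s(2) that] by simp
    qed
    have gS: "gram n S ?g = gram n S g" by (rule gram_usub[OF usub_adj[OF x0(1)] Suc.prems(4)])
    have "gram n (S - {s}) ?g j k \<in> \<real>" if "j \<in> J" "k \<in> J" for j k
    proof -
      have jk: "j < n" "k < n" using that Suc.prems by auto
      have "gram n S ?g j k = cnj (?g s j) * ?g s k + (\<Sum>i\<in>S - {s}. cnj (?g i j) * ?g i k)"
        unfolding gram_apply[OF Suc.prems(2) jk] using Suc.prems(1) s(1) by (rule sum.remove)
      moreover have "gram n (S - {s}) ?g j k = (\<Sum>i\<in>S - {s}. cnj (?g i j) * ?g i k)"
        using Suc.prems(2) jk by (intro gram_apply) auto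
      ultimately have "gram n (S - {s}) ?g j k = gram n S g j k - cnj (?g s j) * ?g s k"
        using gS by simp
      then show ?thesis using Suc.prems(5)[OF that] row[OF that(1)] row[OF that(2)]
        by (simp add: Reals_cnj_iff)
    qed
    moreover have "m = card (S - {s})" using Suc.hyps(2) s(1) Suc.prems(1) by simp
    ultimately obtain x1 where x1: "x1 \<in> usub n (S - {s})" "\<forall>i\<in>S - {s}. \<forall>j\<in>J. mmul n x1 ?g i j \<in> \<real>"
      using Suc.hyps(1)[of "S - {s}" ?g] Suc.prems by auto
    have "mmul n x1 ?g i j \<in> \<real>" if "i \<in> S" "j \<in> J" for i j
      using x1 that row usub_row[OF x1(1), of s ?g j] by (cases "i = s") auto
    then have "\<forall>i\<in>S. \<forall>j\<in>J. mmul n (mmul n x1 (madj x0)) g i j \<in> \<real>" by (simp add: mmul_assoc)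
    moreover have "mmul n x1 (madj x0) \<in> usub n S"
      using usub_mono[of "S - {s}" S n] x1(1) usub_adj[OF x0(1)] by (intro usub_mmul) auto
    ultimately show ?thesis by blast
  qed
qed

text \<open>The eigenvalue comes from \<open>spectrum_non_empty\<close> through a bijection of
  \<open>J\<close> with \<open>{0..<p}\<close>. Norm one is required for the vector to serve as a
  column of a unitary matrix.\<close>

lemma exists_eigenvector:
  fixes A :: "nat \<Rightarrow> nat \<Rightarrow> complex"
  assumes "finite J" "J \<noteq> {}"
  shows "\<exists>v c. (\<Sum>i\<in>J. cnj (v i) * v i) = 1 \<and> (\<forall>i\<in>J. (\<Sum>k\<in>J. A i k * v k) = c * v i)"
proof -
  define p where "p = card J"
  have p: "p > 0" using assms by (simp add: p_def card_gt_0_iff)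
  obtain e where e: "bij_betw e {0..<p} J" using ex_bij_betw_nat_finite[OF assms(1)] p_def by blast
  define M where "M = mat p p (\<lambda>(a, b). A (e a) (e b))"
  have M: "M \<in> carrier_mat p p" by (simp add: M_def)
  obtain c where "eigenvalue M c" using spectrum_non_empty[OF M p] by (auto simp: spectrum_def)
  then obtain w where w: "w \<in> carrier_vec p" "w \<noteq> 0\<^sub>v p" "M *\<^sub>v w = c \<cdot>\<^sub>v w"
    using M by (auto simp: eigenvalue_def eigenvector_def)
  define e' where "e' = the_inv_into {0..<p} e"
  have e': "e' (e a) = a" if "a < p" for a
    unfolding e'_def using e that by (intro the_inv_into_f_f) (auto simp: bij_betw_def)
  define u where "u = (\<lambda>i. w $ e' i)"
  have eig: "(\<Sum>k\<in>J. A i k * u k) = c * u i" if "i \<in> J" for i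
  proof -
    have "i \<in> e ` {0..<p}" using e that by (simp add: bij_betw_def)
    then obtain a where a: "a < p" "i = e a" by auto
    have "(\<Sum>k\<in>J. A i k * u k) = (\<Sum>b\<in>{0..<p}. A i (e b) * u (e b))"
      using e by (rule sum.reindex_bij_betw[symmetric])
    also have "\<dots> = (\<Sum>b\<in>{0..<p}. M $$ (a, b) * w $ b)"
      using a e' by (intro sum.cong) (auto simp: M_def u_def)
    also have "\<dots> = (M *\<^sub>v w) $ a" using a w(1) M by (simp add: scalar_prod_def)
    also have "\<dots> = c * u i" using a w e' by (simp add: u_def)
    finally show ?thesis .
  qed
  have "\<exists>a<p. w $ a \<noteq> 0"
  proof (rule ccontr)
    assume "\<not> ?thesis"
    then have "w = 0\<^sub>v p" using w(1) by (intro eq_vecI) auto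
    then show False using w(2) by simp
  qed
  then obtain a where a: "a < p" "w $ a \<noteq> 0" by blast
  have "e a \<in> J" "u (e a) \<noteq> 0" using a e e' by (auto simp: bij_betw_def u_def)
  then obtain d where d: "(\<Sum>i\<in>J. cnj (complex_of_real d * u i) * (complex_of_real d * u i)) = 1"
    using normalize_on[OF assms(1), of "e a" u] by blast
  have "(\<Sum>k\<in>J. A i k * (complex_of_real d * u k)) = c * (complex_of_real d * u i)" if "i \<in> J" for i
  proof -
    have "(\<Sum>k\<in>J. A i k * (complex_of_real d * u k)) = complex_of_real d * (\<Sum>k\<in>J. A i k * u k)"
      by (simp add: sum_distrib_left mult_ac)
    then show ?thesis using eig[OF that] by (simp add: mult_ac)
  qed
  then show ?thesis using d by (intro exI[of _ "\<lambda>i. complex_of_real d * u i"] exI[of _ c]) auto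
qed

text \<open>Deflation: a unit eigenvector becomes column \<open>s\<close> of the unitary, which
  clears column \<open>s\<close> of the conjugated matrix and, by hermiticity, row \<open>s\<close>.
  Only the compression of \<open>A\<close> to \<open>J\<close> is diagonalised, so the sums for the
  eigenvector run over \<open>J\<close>.\<close>

lemma hermitian_diagonalization:
  assumes "finite J" "J \<subseteq> {..<n}" "A \<in> mats n" "madj A = A"
  shows "\<exists>h\<in>usub n J. \<forall>i\<in>J. \<forall>j\<in>J. i \<noteq> j \<longrightarrow> mmul n (madj h) (mmul n A h) i j = 0"
  using assms
proof (induction "card J" arbitrary: J A)
  case 0
  then show ?case by (intro bexI[of _ "mid n"]) auto
next
  case (Suc m)
  then have ne: "J \<noteq> {}" by auto
  then obtain s where s: "s \<in> J" by blast
  obtain v c where v: "(\<Sum>i\<in>J. cnj (v i) * v i) = 1" "\<forall>i\<in>J. (\<Sum>k\<in>J. A i k * v k) = c * v i"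
    using exists_eigenvector[OF Suc.prems(1) ne] by blast
  obtain h0 where h0: "h0 \<in> usub n J" "\<forall>i\<in>J. h0 i s = v i"
    using exists_usub_column[OF Suc.prems(2) s v(1)] by blast
  let ?A = "mmul n (madj h0) (mmul n A h0)"
  have z: "h0 i j = 0" if "i \<notin> J" "j \<in> J" for i j
    using h0(1) that by (auto simp: usub_def mid_def)
  have Aadj: "madj ?A = ?A" using Suc.prems(4) by (simp add: madj_mmul mmul_assoc)
  have sn: "s < n" using s Suc.prems by auto
  have col: "?A i s = 0" if "i \<in> J" "i \<noteq> s" for i
  proof -
    have "i < n" using that Suc.prems by auto
    have "mmul n A h0 k s = c * h0 k s" if "k \<in> J" for k
    proof -
      have "k < n" using that Suc.prems by auto
      then have "mmul n A h0 k s = (\<Sum>l<n. A k l * h0 l s)" using sn by (simp add: mmul_def)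
      also have "\<dots> = (\<Sum>l\<in>J. A k l * h0 l s)"
        using z s Suc.prems by (intro sum.mono_neutral_right) auto
      also have "\<dots> = (\<Sum>l\<in>J. A k l * v l)" using h0(2) by (intro sum.cong) auto
      finally show ?thesis using v(2) h0(2) that by simp
    qed
    then have *: "cnj (h0 k i) * mmul n A h0 k s = c * (cnj (h0 k i) * h0 k s)" for k
      using z \<open>i \<in> J\<close> by (cases "k \<in> J") auto
    have "?A i s = (\<Sum>k<n. cnj (h0 k i) * mmul n A h0 k s)"
      using sn \<open>i < n\<close> by (subst mmul_def) (simp add: madj_def)
    also have "\<dots> = c * (\<Sum>k<n. cnj (h0 k i) * h0 k s)" unfolding * by (simp add: sum_distrib_left)
    also have "(\<Sum>k<n. cnj (h0 k i) * h0 k s) = 0"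
      using usub_unitary[OF h0(1)] sn \<open>i < n\<close> that by (auto simp: unitary_group_def)
    finally show ?thesis by simp
  qed
  have row: "?A s i = 0" if "i \<in> J" "i \<noteq> s" for i
    using col[OF that] fun_cong[OF fun_cong[OF Aadj], of s i] by (simp add: madj_def)
  have "m = card (J - {s})" using Suc.hyps(2) s Suc.prems(1) by simp
  then obtain h1 where h1: "h1 \<in> usub n (J - {s})"
    "\<forall>i\<in>J - {s}. \<forall>j\<in>J - {s}. i \<noteq> j \<longrightarrow> mmul n (madj h1) (mmul n ?A h1) i j = 0"
    using Suc.hyps(1)[of "J - {s}" ?A] Suc.prems Aadj by auto
  let ?B = "mmul n (madj h1) (mmul n ?A h1)"
  have Badj: "madj ?B = ?B" using Aadj by (simp add: madj_mmul mmul_assoc)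
  \<comment> \<open>\<open>h1\<close> fixes the coordinate \<open>s\<close>, so the zeros already
    produced in row and column \<open>s\<close> survive the second conjugation.\<close>
  have rowB: "?B s j = 0" if "j \<in> J" "j \<noteq> s" for j
  proof -
    have "j < n" using that Suc.prems by auto
    have "?B s j = mmul n ?A h1 s j" by (rule usub_row[OF usub_adj[OF h1(1)]]) auto
    also have "\<dots> = (\<Sum>l<n. ?A s l * h1 l j)" using sn \<open>j < n\<close> by (subst mmul_def) simp
    also have "\<dots> = 0"
    proof (intro sum.neutral ballI)
      fix l assume "l \<in> {..<n}"
      show "?A s l * h1 l j = 0"
      proof (cases "l \<in> J - {s}")
        case True
        then show ?thesis using row by simp
      next
        case False
        then have "h1 l j = mid n l j" using h1(1) by (auto simp: usub_def)
        also have "\<dots> = 0" using False that by (auto simp: mid_def)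
        finally show ?thesis by simp
      qed
    qed
    finally show ?thesis .
  qed
  have colB: "?B j s = 0" if "j \<in> J" "j \<noteq> s" for j
    using rowB[OF that] fun_cong[OF fun_cong[OF Badj], of j s] by (simp add: madj_def)
  have "?B i j = 0" if "i \<in> J" "j \<in> J" "i \<noteq> j" for i j
    using that rowB[of j] colB[of i] h1(2) by (cases "i = s"; cases "j = s") auto
  moreover have "?B = mmul n (madj (mmul n h0 h1)) (mmul n A (mmul n h0 h1))"
    by (simp add: madj_mmul mmul_assoc)
  moreover have "mmul n h0 h1 \<in> usub n J"
    using usub_mono[of "J - {s}" J n] h1(1) h0(1) by (intro usub_mmul) auto
  ultimately show ?case by (intro bexI[of _ "mmul n h0 h1"]) auto
qed

lemma gram_diagonalization:
  assumes "J \<subseteq> {..<n}"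
  shows "\<exists>h\<in>usub n J. \<forall>i\<in>J. \<forall>j\<in>J. i \<noteq> j \<longrightarrow> gram n S (mmul n g h) i j = 0"
  using hermitian_diagonalization[of J n "gram n S g"] assms finite_subset[OF assms]
  by (simp add: gram_mmul_right gram_adj) (simp add: gram_def)

text \<open>The blocks can be treated one after the other: a unitary on one block leaves the rows in
  the other blocks alone, and no block unitary changes any of the Gram matrices.\<close>

lemma real_block_grams_imp_real_columns:
  assumes n: "sum_list ns = n" and J: "J \<subseteq> {..<n}" and g: "g \<in> mats n"
    and re: "\<And>a j k. j \<in> J \<Longrightarrow> k \<in> J \<Longrightarrow> gram n (block ns a) g j k \<in> \<real>"
  shows "\<exists>x\<in>block_unitary n ns. \<forall>i<n. \<forall>j\<in>J. mmul n x g i j \<in> \<real>"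
proof -
  have "\<exists>x\<in>block_unitary n ns. \<forall>i<n. block_of ns i < m \<longrightarrow> (\<forall>j\<in>J. mmul n x g i j \<in> \<real>)" for m
  proof (induction m)
    case 0
    then show ?case by (intro bexI[of _ "mid n"]) auto
  next
    case (Suc m)
    then obtain x where x: "x \<in> block_unitary n ns" "\<forall>i<n. block_of ns i < m \<longrightarrow> (\<forall>j\<in>J. mmul n x g i j \<in> \<real>)"
      by blast
    have "gram n (block ns m) (mmul n x g) j k \<in> \<real>" if "j \<in> J" "k \<in> J" for j k
      unfolding gram_block[OF x(1) g n] by (rule re[OF that])
    then obtain y where y: "y \<in> usub n (block ns m)" "\<forall>i\<in>block ns m. \<forall>j\<in>J. mmul n y (mmul n x g) i j \<in> \<real>"
      using real_gram_imp_real_rows[of "block ns m" n J "mmul n x g"] block_subset[OF n] J by auto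
    have "mmul n y (mmul n x g) i j \<in> \<real>" if "i < n" "block_of ns i < Suc m" "j \<in> J" for i j
    proof (cases "i \<in> block ns m")
      case True
      then show ?thesis using y(2) that by blast
    next
      case False
      then have "block_of ns i < m" using that n by (auto simp: block_def)
      then show ?thesis using usub_row[OF y(1) False, of "mmul n x g"] x(2) that by simp
    qed
    moreover have "mmul n y x \<in> block_unitary n ns"
      using usub_block[OF y(1)] x(1) block_unitary_mmul by blast
    ultimately show ?case by (intro bexI[of _ "mmul n y x"]) (auto simp: mmul_assoc)
  qed
  from this[of "length ns"] show ?thesis using block_of_less_length n by blast
qed

text \<open>The real columns in \<open>J\<close> extend to a real orthonormal basis, the columns of
  \<open>r\<close>. Since \<open>r\<close> and \<open>g\<close> agree on \<open>J\<close>, the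
  quotient \<open>madj r\<close> times \<open>g\<close> is the identity in the rows and columns of
  \<open>J\<close>.\<close>

lemma real_columns_imp_factor:
  assumes g: "g \<in> unitary_group n" and J: "J \<subseteq> {..<n}" and re: "\<And>i j. i < n \<Longrightarrow> j \<in> J \<Longrightarrow> g i j \<in> \<real>"
  shows "\<exists>r\<in>orthogonal_group n. \<exists>h\<in>usub n ({..<n} - J). g = mmul n r h"
proof -
  have gz: "g i j = 0" if "\<not> i < n" for i j using unitary_mats[OF g] that by (auto simp: mats_def)
  have gre: "g i j \<in> \<real>" if "j \<in> J" for i j using re[of i j] gz[of i j] that by (cases "i < n") auto
  have gor: "(\<Sum>k<n. cnj (g k i) * g k j) = (if i = j then 1 else 0)" if "i < n" "j < n" for i j
    using g that by (auto simp: unitary_group_def)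
  have "R.onf n J (\<lambda>j i. Re (g i j))"
  proof -
    have "R.ip n (\<lambda>k. Re (g k i)) (\<lambda>k. Re (g k j)) = (if i = j then 1 else 0)" if "i \<in> J" "j \<in> J" for i j
    proof -
      have "complex_of_real (R.ip n (\<lambda>k. Re (g k i)) (\<lambda>k. Re (g k j))) = (\<Sum>k<n. cnj (g k i) * g k j)"
        unfolding R.ip_def of_real_sum of_real_mult
        using gre that by (intro sum.cong) (auto simp: Reals_cnj_iff of_real_Re)
      also have "\<dots> = (if i = j then 1 else 0)" using that J by (intro gor) auto
      finally show ?thesis by (metis of_real_eq_iff of_real_0 of_real_1)
    qed
    then show ?thesis using gz unfolding R.onf_def R.vecs_def by auto
  qed
  then obtain f where f: "R.onf n {..<n} f" "\<forall>j\<in>J. f j = (\<lambda>i. Re (g i j))"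
    using R.onf_extend[OF J] by blast
  define r where "r = (\<lambda>i j. if j < n then complex_of_real (f j i) else 0)"
  have r: "r \<in> orthogonal_group n" unfolding r_def by (rule orthogonal_of_onf[OF f(1)])
  note ru = orthogonal_unitary[OF r]
  have rg: "r i j = g i j" if "j \<in> J" for i j
    using f(2) that J gre by (auto simp: r_def of_real_Re)
  let ?h = "mmul n (madj r) g"
  have hu: "?h \<in> unitary_group n" using ru g by (simp add: unitary_mmul unitary_adj)
  have "?h i j = mid n i j" if "i \<notin> {..<n} - J \<or> j \<notin> {..<n} - J" for i j
  proof (cases "i < n \<and> j < n")
    case False
    then show ?thesis by (auto simp: mmul_def mid_def)
  next
    case True
    have rr: "(\<Sum>k<n. cnj (r k i) * r k j) = (if i = j then 1 else 0)"
      using ru True by (auto simp: unitary_group_def)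
    have "i \<in> J \<or> j \<in> J" using that True by auto
    then have "(\<Sum>k<n. cnj (r k i) * g k j) = (if i = j then 1 else 0)"
    proof
      assume "i \<in> J"
      then show ?thesis using rg gor True by simp
    next
      assume "j \<in> J"
      then show ?thesis using rg rr by simp
    qed
    then show ?thesis using True by (simp add: mmul_def madj_def mid_def)
  qed
  then have "?h \<in> usub n ({..<n} - J)" using hu by (auto simp: usub_def)
  moreover have "g = mmul n r ?h" using unitary_cancel_left'[OF ru unitary_mats[OF g]] by simp
  ultimately show ?thesis using r by blast
qed

text \<open>Here \<open>l = 2\<close> enters: a unitary on the complement of one block is again a
  member of the block group.\<close>

lemma two_blocks_complement:
  assumes "length ms = 2" "sum_list ms = n" "b < 2"
  shows "{..<n} - block ms b = block ms (1 - b)"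
proof -
  have "block_of ms i < 2" if "i < n" for i using block_of_less_length[of i ms] that assms by simp
  then have "block_of ms i \<noteq> b \<longleftrightarrow> block_of ms i = 1 - b" if "i < n" for i
    using that assms(3) by (metis One_nat_def diff_self_eq_0 diff_zero less_2_cases_iff zero_neq_one)
  then show ?thesis using assms by (auto simp: block_def)
qed

text \<open>The common reduction of all sufficient cases: it is enough to look at the columns of one
  block, and \<open>b\<close> can be chosen as the smaller one.\<close>

lemma triple_product_of_real_grams:
  assumes n: "sum_list ns = n" "sum_list ms = n" and ms: "length ms = 2" "b < 2"
    and re: "\<And>g. g \<in> unitary_group n \<Longrightarrow> \<exists>h\<in>usub n (block ms b). \<forall>a<length ns. \<forall>j\<in>block ms b. \<forall>k\<in>block ms b.
      gram n (block ns a) (mmul n g h) j k \<in> \<real>"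
  shows "triple_product n ns ms"
  unfolding triple_product_def
proof
  fix g assume g: "g \<in> unitary_group n"
  let ?J = "block ms b"
  obtain h where h: "h \<in> usub n ?J" "\<forall>a<length ns. \<forall>j\<in>?J. \<forall>k\<in>?J. gram n (block ns a) (mmul n g h) j k \<in> \<real>"
    using re[OF g] by blast
  note hu = usub_unitary[OF h(1)]
  \<comment> \<open>Block numbers beyond the list give empty blocks, whose Gram matrices
    vanish.\<close>
  have gr: "gram n (block ns a) (mmul n g h) j k \<in> \<real>" if "j \<in> ?J" "k \<in> ?J" for a j k
  proof (cases "a < length ns")
    case False
    then have "block ns a = {}" using block_of_less_length by (auto simp: block_def)
    then show ?thesis using block_subset[OF n(2), of b] that by (subst gram_apply) auto
  qed (use h that in blast)
  have gh: "mmul n g h \<in> unitary_group n" using g hu by (rule unitary_mmul)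
  obtain x where x: "x \<in> block_unitary n ns" "\<forall>i<n. \<forall>j\<in>?J. mmul n x (mmul n g h) i j \<in> \<real>"
    using real_block_grams_imp_real_columns[OF n(1) block_subset[OF n(2)] unitary_mats[OF gh] gr] by blast
  note xu = block_unitary_unitary[OF x(1)]
  obtain r h' where r: "r \<in> orthogonal_group n" "h' \<in> usub n ({..<n} - ?J)" "mmul n x (mmul n g h) = mmul n r h'"
    using real_columns_imp_factor[OF unitary_mmul[OF xu gh] block_subset[OF n(2)]] x(2) by blast
  have "h' \<in> block_unitary n ms"
    using usub_block[OF r(2)] two_blocks_complement[OF ms(1) n(2) ms(2)] by blast
  moreover have "h \<in> block_unitary n ms" using usub_block[OF h(1)] by blast
  ultimately have hh: "mmul n h' (madj h) \<in> block_unitary n ms"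
    by (intro block_unitary_mmul block_unitary_adj)
  have "mmul n (madj x) (mmul n r (mmul n h' (madj h))) = mmul n (mmul n (madj x) (mmul n r h')) (madj h)"
    by (simp add: mmul_assoc)
  also have "\<dots> = mmul n (mmul n g h) (madj h)"
    using unitary_cancel_left[OF xu, of "mmul n g h"] by (simp flip: r(3))
  also have "\<dots> = g" using unitary_adj_right[OF hu] unitary_mats[OF g] by (simp add: mmul_assoc)
  finally show "\<exists>x\<in>block_unitary n ns. \<exists>g'\<in>orthogonal_group n. \<exists>h\<in>block_unitary n ms. g = mmul n x (mmul n g' h)"
    using block_unitary_adj[OF x(1)] r(1) hh by metis
qed

section \<open>Sufficient numerical cases\<close>

lemma gram_blocks_all_but_one_real:
  assumes "g \<in> unitary_group n" "sum_list ns = n" "j < n" "k < n" "c < length ns"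
    and "\<And>a. a < length ns \<Longrightarrow> a \<noteq> c \<Longrightarrow> gram n (block ns a) g j k \<in> \<real>"
  shows "gram n (block ns c) g j k \<in> \<real>"
proof -
  have "(\<Sum>a<length ns. gram n (block ns a) g j k) =
    gram n (block ns c) g j k + (\<Sum>a\<in>{..<length ns} - {c}. gram n (block ns a) g j k)"
    using assms by (intro sum.remove) auto
  then have "gram n (block ns c) g j k =
    (if j = k then 1 else 0) - (\<Sum>a\<in>{..<length ns} - {c}. gram n (block ns a) g j k)"
    using sum_gram_blocks[OF assms(1-4)] by simp
  also have "\<dots> \<in> \<real>" using assms(6) by (intro Reals_diff sum_in_Reals) auto
  finally show ?thesis .
qed

definition torus :: "nat \<Rightarrow> nat set \<Rightarrow> (nat \<Rightarrow> complex) \<Rightarrow> nat \<Rightarrow> nat \<Rightarrow> complex" where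
  "torus n J t = (\<lambda>i j. if i = j \<and> i < n then (if i \<in> J then t i else 1) else 0)"

lemma torus_usub:
  assumes "\<And>j. j \<in> J \<Longrightarrow> norm (t j) = 1"
  shows "torus n J t \<in> usub n J"
proof -
  have "cnj (t j) * t j = 1" if "j \<in> J" for j
    using assms[OF that] complex_norm_square[of "t j"] by (simp add: mult.commute)
  then have "mmul n (madj (torus n J t)) (torus n J t) = mid n"
    by (intro ext) (auto simp: mmul_def madj_def torus_def mid_def if_distrib[of cnj]
        if_distrib[of "\<lambda>x. x * _"] if_distrib[of "\<lambda>x. _ * x"] cong: if_cong)
  moreover have "torus n J t \<in> mats n" by (auto simp: torus_def mats_def)
  ultimately have "torus n J t \<in> unitary_group n" by (simp add: unitary_iff)
  then show ?thesis by (auto simp: usub_def torus_def mid_def)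
qed

lemma gram_torus:
  assumes "S \<subseteq> {..<n}" "J \<subseteq> {..<n}" "j \<in> J" "k \<in> J"
  shows "gram n S (mmul n g (torus n J t)) j k = cnj (t j) * t k * gram n S g j k"
proof -
  have jk: "j < n" "k < n" using assms by auto
  have *: "mmul n g (torus n J t) i j = g i j * t j" if "i < n" "j \<in> J" "j < n" for i j
    using that by (simp add: mmul_def torus_def if_distrib[of "\<lambda>x. _ * x"] cong: if_cong)
  have "gram n S (mmul n g (torus n J t)) j k = (\<Sum>i\<in>S. cnj (t j) * t k * (cnj (g i j) * g i k))"
    unfolding gram_apply[OF assms(1) jk] using assms jk * by (intro sum.cong) auto
  then show ?thesis using gram_apply[OF assms(1) jk] by (simp add: sum_distrib_left)
qed

lemma exists_phase: "\<exists>t::complex. norm t = 1 \<and> z * t \<in> \<real>"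
proof (cases "z = 0")
  case False
  have "z * cnj (sgn z) = complex_of_real (norm z)"
    using complex_norm_square[of z] False
    by (simp add: sgn_div_norm scaleR_conv_of_real power2_eq_square field_simps)
  then show ?thesis using False by (intro exI[of _ "cnj (sgn z)"]) (simp add: norm_sgn)
qed (auto intro: exI[of _ 1])

lemma card_block: "a < length ns \<Longrightarrow> card (block ns a) = ns ! a"
proof -
  assume a: "a < length ns"
  have "block ns a = {sum_list (take a ns)..<sum_list (take (Suc a) ns)}"
  proof (rule Set.set_eqI)
    fix i
    show "i \<in> block ns a \<longleftrightarrow> i \<in> {sum_list (take a ns)..<sum_list (take (Suc a) ns)}"
      using sum_list_take_le[of "Suc a" ns] block_of_eq_iff[of i ns a]
      by (cases "i < sum_list ns") (auto simp: block_def)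
  qed
  then show ?thesis using a by (simp add: take_Suc_conv_app_nth)
qed

lemma triple_product_two_two:
  assumes n: "sum_list ns = n" "sum_list ms = n" and "length ms = 2" "length ns = 2"
  shows "triple_product n ns ms"
proof (rule triple_product_of_real_grams[OF n, of 0])
  fix g assume g: "g \<in> unitary_group n"
  let ?J = "block ms 0"
  have J: "?J \<subseteq> {..<n}" by (rule block_subset[OF n(2)])
  obtain h where h: "h \<in> usub n ?J" "\<forall>i\<in>?J. \<forall>j\<in>?J. i \<noteq> j \<longrightarrow> gram n (block ns 0) (mmul n g h) i j = 0"
    using gram_diagonalization[OF J] by blast
  have gh: "mmul n g h \<in> unitary_group n" using g usub_unitary[OF h(1)] by (rule unitary_mmul)
  have r0: "gram n (block ns 0) (mmul n g h) j k \<in> \<real>" if "j \<in> ?J" "k \<in> ?J" for j k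
    using h(2) that gram_diag_real by (cases "j = k") auto
  have "gram n (block ns a) (mmul n g h) j k \<in> \<real>" if "a < length ns" "j \<in> ?J" "k \<in> ?J" for a j k
  proof (cases "a = 0")
    case False
    have "j < n" "k < n" using that J by auto
    moreover have "e = 0" if "e < length ns" "e \<noteq> a" for e
      using False that \<open>a < length ns\<close> assms(4) by linarith
    ultimately show ?thesis
      using r0[OF that(2,3)] by (intro gram_blocks_all_but_one_real[OF gh n(1) _ _ that(1)]) metis+
  qed (use r0 that in simp)
  then show "\<exists>h\<in>usub n ?J. \<forall>a<length ns. \<forall>j\<in>?J. \<forall>k\<in>?J. gram n (block ns a) (mmul n g h) j k \<in> \<real>"
    using h(1) by blast
qed (use assms in auto)

lemma triple_product_one:
  assumes n: "sum_list ns = n" "sum_list ms = n" and ms: "length ms = 2" "b < 2" "ms ! b = 1"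
  shows "triple_product n ns ms"
proof (rule triple_product_of_real_grams[OF n ms(1,2)])
  fix g assume g: "g \<in> unitary_group n"
  obtain r where r: "block ms b = {r}" using card_block[of b ms] ms by (auto simp: card_1_singleton_iff)
  show "\<exists>h\<in>usub n (block ms b). \<forall>a<length ns. \<forall>j\<in>block ms b. \<forall>k\<in>block ms b. gram n (block ns a) (mmul n g h) j k \<in> \<real>"
    using r gram_diag_real by (intro bexI[of _ "mid n"]) auto
qed

text \<open>Block \<open>d\<close> is diagonalised, which survives conjugation by a diagonal matrix;
  the phases then make block \<open>a\<close> real, and the third block follows from the sum
  relation. Phases are demanded for every unitary because they are chosen only after the
  diagonalisation has changed \<open>g\<close>.\<close>

lemma triple_product_three:
  assumes n: "sum_list ns = n" "sum_list ms = n" and ms: "length ms = 2" "b < 2" and ns: "length ns = 3" "a < 3"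
    and phases: "\<And>g. g \<in> unitary_group n \<Longrightarrow> \<exists>t. (\<forall>j\<in>block ms b. norm (t j) = 1) \<and>
      (\<forall>j\<in>block ms b. \<forall>k\<in>block ms b. cnj (t j) * t k * gram n (block ns a) g j k \<in> \<real>)"
  shows "triple_product n ns ms"
proof (rule triple_product_of_real_grams[OF n ms(1,2)])
  fix g assume g: "g \<in> unitary_group n"
  let ?J = "block ms b"
  have J: "?J \<subseteq> {..<n}" by (rule block_subset[OF n(2)])
  obtain d where d: "d < 3" "d \<noteq> a"
    by (cases "a = 0") (auto intro: that[of 1] that[of 0])
  obtain h where h: "h \<in> usub n ?J" "\<forall>i\<in>?J. \<forall>j\<in>?J. i \<noteq> j \<longrightarrow> gram n (block ns d) (mmul n g h) i j = 0"
    using gram_diagonalization[OF J] by blast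
  have gh: "mmul n g h \<in> unitary_group n" using g usub_unitary[OF h(1)] by (rule unitary_mmul)
  obtain t where t: "\<forall>j\<in>?J. norm (t j) = 1"
    "\<forall>j\<in>?J. \<forall>k\<in>?J. cnj (t j) * t k * gram n (block ns a) (mmul n g h) j k \<in> \<real>"
    using phases[OF gh] by blast
  let ?T = "torus n ?J t"
  have T: "?T \<in> usub n ?J" using t(1) by (intro torus_usub) auto
  let ?g = "mmul n (mmul n g h) ?T"
  have gu: "?g \<in> unitary_group n" using gh usub_unitary[OF T] by (rule unitary_mmul)
  have G: "gram n (block ns c) ?g j k = cnj (t j) * t k * gram n (block ns c) (mmul n g h) j k" if "j \<in> ?J" "k \<in> ?J" for c j k
    by (rule gram_torus[OF block_subset[OF n(1)] J that])
  have ra: "gram n (block ns a) ?g j k \<in> \<real>" if "j \<in> ?J" "k \<in> ?J" for j k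
    unfolding G[OF that] using t(2) that by blast
  have rd: "gram n (block ns d) ?g j k \<in> \<real>" if "j \<in> ?J" "k \<in> ?J" for j k
  proof (cases "j = k")
    case True
    then show ?thesis using gram_diag_real by blast
  next
    case False
    then show ?thesis unfolding G[OF that] using h(2) that by simp
  qed
  have "gram n (block ns c) ?g j k \<in> \<real>" if "c < length ns" "j \<in> ?J" "k \<in> ?J" for c j k
  proof (cases "c = a \<or> c = d")
    case False
    have "j < n" "k < n" using that J by auto
    moreover have "e = a \<or> e = d" if "e < length ns" "e \<noteq> c" for e
      using False that \<open>c < length ns\<close> ns d by linarith
    ultimately show ?thesis
      using ra[OF that(2,3)] rd[OF that(2,3)]
      by (intro gram_blocks_all_but_one_real[OF gu n(1) _ _ that(1)]) metis+
  qed (use ra rd that in auto)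
  then have "\<forall>c<length ns. \<forall>j\<in>?J. \<forall>k\<in>?J. gram n (block ns c) (mmul n g (mmul n h ?T)) j k \<in> \<real>"
    unfolding mmul_assoc by blast
  then show "\<exists>h\<in>usub n ?J. \<forall>c<length ns. \<forall>j\<in>?J. \<forall>k\<in>?J. gram n (block ns c) (mmul n g h) j k \<in> \<real>"
    using usub_mmul[OF h(1) T] by blast
qed

text \<open>A block with a single row \<open>r\<close> has Gram entries
  \<open>cnj (g r j) * g r k\<close>, so turning each \<open>g r j\<close> to the real axis makes
  all of them real at once.\<close>

lemma triple_product_three_one:
  assumes n: "sum_list ns = n" "sum_list ms = n" and ms: "length ms = 2" and ns: "length ns = 3" "a < 3" "ns ! a = 1"
  shows "triple_product n ns ms"
proof (rule triple_product_three[OF n ms _ ns(1,2), of 0])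
  fix g :: "nat \<Rightarrow> nat \<Rightarrow> complex"
  let ?J = "block ms 0"
  obtain r where r: "block ns a = {r}" using card_block[of a ns] ns by (auto simp: card_1_singleton_iff)
  have rn: "r < n" using r block_subset[OF n(1), of a] by auto
  define t where "t = (\<lambda>j. SOME t. norm t = 1 \<and> g r j * t \<in> \<real>)"
  have t: "norm (t j) = 1" "g r j * t j \<in> \<real>" for j
    unfolding t_def using someI_ex[OF exists_phase[of "g r j"]] by auto
  have "cnj (t j) * t k * gram n (block ns a) g j k \<in> \<real>" if "j \<in> ?J" "k \<in> ?J" for j k
  proof -
    have "j < n" "k < n" using that block_subset[OF n(2), of 0] by auto
    then have "cnj (t j) * t k * gram n (block ns a) g j k = cnj (g r j * t j) * (g r k * t k)"
      using r rn by (simp add: gram_apply mult_ac)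
    also have "\<dots> \<in> \<real>" using t(2)[of j] t(2)[of k] by (metis Reals_cnj_iff Reals_mult)
    finally show ?thesis .
  qed
  then show "\<exists>t. (\<forall>j\<in>?J. norm (t j) = 1) \<and> (\<forall>j\<in>?J. \<forall>k\<in>?J. cnj (t j) * t k * gram n (block ns a) g j k \<in> \<real>)"
    using t(1) by blast
qed auto

text \<open>A hermitian matrix of size two has one off-diagonal entry up to conjugation, so one
  relative phase suffices.\<close>

lemma triple_product_three_two:
  assumes n: "sum_list ns = n" "sum_list ms = n" and ms: "length ms = 2" "b < 2" "ms ! b = 2" and ns: "length ns = 3"
  shows "triple_product n ns ms"
proof (rule triple_product_three[OF n ms(1,2) ns, of 0])
  fix g
  let ?J = "block ms b"
  have "card ?J = 2" using card_block[of b ms] ms by simp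
  then obtain p q where pq: "?J = {p, q}" "p \<noteq> q" by (auto simp: card_2_iff)
  let ?G = "gram n (block ns 0) g"
  obtain s where s: "norm s = 1" "?G p q * s \<in> \<real>" using exists_phase by blast
  define t where "t = (\<lambda>j. if j = p then 1 else s)"
  have "cnj s * ?G q p = cnj (?G p q * s)" using gram_hermitian[of n "block ns 0" g q p] by simp
  then have "cnj s * ?G q p \<in> \<real>" using s(2) by (metis Reals_cnj_iff)
  moreover have "cnj s * s = 1" using s(1) complex_norm_square[of s] by (simp add: mult.commute)
  ultimately have "cnj (t j) * t k * ?G j k \<in> \<real>" if "j \<in> ?J" "k \<in> ?J" for j k
    using that pq s gram_diag_real by (auto simp: t_def mult.commute)
  then show "\<exists>t. (\<forall>j\<in>?J. norm (t j) = 1) \<and> (\<forall>j\<in>?J. \<forall>k\<in>?J. cnj (t j) * t k * ?G j k \<in> \<real>)"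
    using s(1) by (intro exI[of _ t]) (auto simp: t_def)
qed auto

subsection \<open>Real traces and necessity\<close>

definition mtrace :: "nat \<Rightarrow> (nat \<Rightarrow> nat \<Rightarrow> complex) \<Rightarrow> complex" where
  "mtrace n X = (\<Sum>i<n. X i i)"

lemma mtrace_mmul_commute: "mtrace n (mmul n X Y) = mtrace n (mmul n Y X)"
proof -
  have "(\<Sum>i<n. \<Sum>k<n. X i k * Y k i) = (\<Sum>k<n. \<Sum>i<n. X i k * Y k i)" by (rule sum.swap)
  then show ?thesis by (simp add: mtrace_def mmul_def mult.commute)
qed

text \<open>On this set, entrywise conjugation is implemented by one fixed unitary \<open>z\<close>.
  Products stay in the set, and traces are real because conjugating by \<open>z\<close> does not
  change a trace.\<close>

definition conj_by :: "nat \<Rightarrow> (nat \<Rightarrow> nat \<Rightarrow> complex) \<Rightarrow> (nat \<Rightarrow> nat \<Rightarrow> complex) set" where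
  "conj_by n z = {X \<in> mats n. mconj X = mmul n (madj z) (mmul n X z)}"

lemma conj_by_mmul:
  assumes z: "z \<in> unitary_group n" and XY: "X \<in> conj_by n z" "Y \<in> conj_by n z"
  shows "mmul n X Y \<in> conj_by n z"
proof -
  have "mconj (mmul n X Y) = mmul n (madj z) (mmul n X (mmul n z (mmul n (madj z) (mmul n Y z))))"
    using XY by (simp add: conj_by_def mconj_mmul mmul_assoc)
  also have "mmul n z (mmul n (madj z) (mmul n Y z)) = mmul n Y z"
    by (rule unitary_cancel_left'[OF z]) simp
  finally show ?thesis by (simp add: conj_by_def mmul_assoc)
qed

lemma conj_by_trace_real:
  assumes z: "z \<in> unitary_group n" and X: "X \<in> conj_by n z"
  shows "mtrace n X \<in> \<real>"
proof -
  have "cnj (mtrace n X) = mtrace n (mconj X)" by (simp add: mtrace_def mconj_def)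
  also have "\<dots> = mtrace n (mmul n (madj z) (mmul n X z))" using X by (simp add: conj_by_def)
  also have "\<dots> = mtrace n (mmul n (mmul n X z) (madj z))" by (rule mtrace_mmul_commute)
  also have "\<dots> = mtrace n X"
    using X unitary_adj_right[OF z] by (simp add: mmul_assoc conj_by_def)
  finally show ?thesis by (simp add: Reals_cnj_iff)
qed

lemma triple_product_conj:
  assumes "triple_product n ns ms" "g \<in> unitary_group n"
  shows "\<exists>y\<in>block_unitary n ns. \<exists>z\<in>block_unitary n ms. mconj g = mmul n y (mmul n g z)"
proof -
  obtain x r h where *: "x \<in> block_unitary n ns" "r \<in> orthogonal_group n" "h \<in> block_unitary n ms"
    "g = mmul n x (mmul n r h)" using assms unfolding triple_product_def by blast
  \<comment> \<open>Complex conjugation fixes \<open>r\<close>, so \<open>mconj g\<close> differs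
    from \<open>g\<close> only by exchanging \<open>x\<close> and \<open>h\<close> for their
    conjugates.\<close>
  let ?y = "mmul n (mconj x) (madj x)" and ?z = "mmul n (madj h) (mconj h)"
  note xu = block_unitary_unitary[OF *(1)] and hu = block_unitary_unitary[OF *(3)]
  have r: "mconj r = r" using *(2) by (auto simp: orthogonal_group_def mconj_def Reals_cnj_iff)
  have hc: "mconj h \<in> mats n" using unitary_mats[OF unitary_conj[OF hu]] .
  have "mmul n ?y (mmul n g ?z) =
    mmul n (mconj x) (mmul n (madj x) (mmul n x (mmul n r (mmul n h (mmul n (madj h) (mconj h))))))"
    unfolding *(4) by (simp add: mmul_assoc)
  also have "mmul n h (mmul n (madj h) (mconj h)) = mconj h" by (rule unitary_cancel_left'[OF hu hc])
  also have "mmul n (madj x) (mmul n x (mmul n r (mconj h))) = mmul n r (mconj h)"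
    by (rule unitary_cancel_left[OF xu]) simp
  also have "mmul n (mconj x) (mmul n r (mconj h)) = mconj g"
    unfolding *(4) by (simp add: mconj_mmul r)
  finally have "mconj g = mmul n ?y (mmul n g ?z)" by simp
  moreover have "?y \<in> block_unitary n ns" using *(1) by (intro block_unitary_mmul block_unitary_conj block_unitary_adj)
  moreover have "?z \<in> block_unitary n ms" using *(3) by (intro block_unitary_mmul block_unitary_conj block_unitary_adj)
  ultimately show ?thesis by blast
qed

text \<open>The corner of a Gram matrix between two column blocks. Corners with \<open>b\<close>
  different from \<open>c\<close> are what detects relative phases when three or more column blocks
  are present.\<close>

definition block_gram :: "nat \<Rightarrow> nat list \<Rightarrow> nat list \<Rightarrow> (nat \<Rightarrow> nat \<Rightarrow> complex) \<Rightarrow> nat \<Rightarrow> nat \<Rightarrow> nat \<Rightarrow> nat \<Rightarrow> nat \<Rightarrow> complex" where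
  "block_gram n ns ms g b a c = (\<lambda>j k. if j \<in> block ms b \<and> k \<in> block ms c then gram n (block ns a) g j k else 0)"

text \<open>The factor in \<open>L\<close> drops out of every Gram matrix, and \<open>z\<close>,
  being in \<open>H\<close>, commutes with the projections \<open>?E b\<close>. One \<open>z\<close>
  serves all corners, which is what allows words in several of them.\<close>

lemma triple_product_real_words:
  assumes n: "sum_list ns = n" "sum_list ms = n" and T: "triple_product n ns ms" and g: "g \<in> unitary_group n"
  shows "\<exists>z\<in>unitary_group n. \<forall>b a c. block_gram n ns ms g b a c \<in> conj_by n z"
proof -
  obtain y z where y: "y \<in> block_unitary n ns" and z: "z \<in> block_unitary n ms" and
    c: "mconj g = mmul n y (mmul n g z)" using triple_product_conj[OF T g] by blast
  note zu = block_unitary_unitary[OF z]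
  have G: "gram n (block ns a) g \<in> conj_by n z" for a
  proof -
    have "row_mask S (mconj g) = mconj (row_mask S g)" for S
      by (intro ext) (simp add: row_mask_def mconj_def)
    then have "mconj (gram n (block ns a) g) = gram n (block ns a) (mconj g)"
      by (simp add: gram_def mconj_mmul) (simp add: madj_def mconj_def)
    also have "\<dots> = gram n (block ns a) (mmul n g z)"
      unfolding c by (rule gram_block[OF y _ n(1)]) simp
    also have "\<dots> = mmul n (madj z) (mmul n (gram n (block ns a) g) z)" by (rule gram_mmul_right)
    finally show ?thesis by (simp add: conj_by_def gram_def)
  qed
  let ?E = "\<lambda>b. row_mask (block ms b) (mid n)"
  have E: "?E b \<in> conj_by n z" for b
  proof -
    have zz: "z i k = 0" if "i < n" "k < n" "(i \<in> block ms b) \<noteq> (k \<in> block ms b)" for i k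
      using z that n by (auto simp: block_unitary_def block_def)
    have "mmul n (?E b) z = row_mask (block ms b) (mmul n (mid n) z)" by (simp add: row_mask_mmul_right)
    also have "\<dots> = row_mask (block ms b) (mmul n z (mid n))" using unitary_mats[OF zu] by simp
    also have "\<dots> = mmul n z (?E b)" by (rule row_mask_mmul_left[OF zz])
    finally have "mmul n (madj z) (mmul n (?E b) z) = ?E b"
      using unitary_cancel_left[OF zu, of "?E b"] by simp
    moreover have "mconj (?E b) = ?E b" by (intro ext) (auto simp: mconj_def row_mask_def mid_def)
    ultimately show ?thesis by (simp add: conj_by_def)
  qed
  have "block_gram n ns ms g b a c = mmul n (?E b) (mmul n (gram n (block ns a) g) (?E c))" for b a c
  proof (intro ext)
    fix j k
    have "mmul n Y (?E c) j k = (if k \<in> block ms c then Y j k else 0)" if "Y \<in> mats n" for Y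
    proof (cases "j < n \<and> k < n")
      case True
      have "mmul n Y (?E c) j k = (\<Sum>l<n. Y j l * ?E c l k)" using True by (simp add: mmul_def)
      also have "\<dots> = (\<Sum>l<n. if l = k then (if k \<in> block ms c then Y j k else 0) else 0)"
        by (intro sum.cong refl) (auto simp: row_mask_def mid_def)
      finally show ?thesis using True by simp
    qed (use that in \<open>auto simp: mmul_def mats_def\<close>)
    moreover have "gram n (block ns a) g \<in> mats n" by (simp add: gram_def)
    moreover have "mmul n (?E b) Y j k = (if j \<in> block ms b then Y j k else 0)" if "Y \<in> mats n" for Y
      using that by (simp flip: row_mask_mmul_right) (simp add: row_mask_def)
    ultimately show "block_gram n ns ms g b a c j k = mmul n (?E b) (mmul n (gram n (block ns a) g) (?E c)) j k"
      by (simp add: block_gram_def)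
  qed
  then have "block_gram n ns ms g b a c \<in> conj_by n z" for b a c
    using conj_by_mmul[OF zu E conj_by_mmul[OF zu G E]] by simp
  then show ?thesis using zu by blast
qed

section \<open>Placing a small configuration in a large unitary matrix\<close>

lemma exists_unitary_with_columns:
  assumes S: "S \<subseteq> {..<n}" "C \<subseteq> S" and R: "R \<subseteq> {..<n}" and D: "D \<subseteq> {..<n}" "card D = card R" "S \<inter> D = C"
    and u: "\<And>j k. j \<in> C \<Longrightarrow> k \<in> C \<Longrightarrow> (\<Sum>i\<in>R. cnj (u i j) * u i k) = (if j = k then 1 else 0)"
  shows "\<exists>g\<in>unitary_group n. \<exists>\<sigma>. (\<forall>j\<in>C. \<forall>i. g i j = (if i \<in> R then u i j else 0)) \<and>
    (\<forall>j\<in>S - C. \<sigma> j \<notin> R \<and> (\<forall>i. g i j = (if i = \<sigma> j then 1 else 0)))"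
proof -
  have fin: "finite S" "finite R" "finite D" using S R D finite_subset[of _ "{..<n}"] by auto
  \<comment> \<open>\<open>D\<close> supplies the count: it has as many columns as \<open>R\<close>
    has rows and meets \<open>S\<close> only in \<open>C\<close>, so the standard columns in
    \<open>S - C\<close> find distinct rows outside \<open>R\<close>.\<close>
  have "card (S - C) \<le> card ({..<n} - D)" using S D by (intro card_mono) auto
  also have "\<dots> = card ({..<n} - R)" using D(1,2) R fin by (simp add: card_Diff_subset)
  finally obtain \<sigma> where \<sigma>: "inj_on \<sigma> (S - C)" "\<sigma> ` (S - C) \<subseteq> {..<n} - R"
    using card_le_inj[of "S - C" "{..<n} - R"] fin by auto
  define e where "e = (\<lambda>j. if j \<in> C then (\<lambda>i. if i \<in> R then u i j else 0) else C.unit_vec (\<sigma> j))"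
  have \<sigma>': "\<sigma> j < n" "\<sigma> j \<notin> R" if "j \<in> S" "j \<notin> C" for j using \<sigma>(2) that by auto
  have "C.onf n S e"
  proof -
    have "e j \<in> C.vecs n" if "j \<in> S" for j
      using that R \<sigma>'(1)[of j] by (auto simp: e_def C.vecs_def C.unit_vec_def)
    moreover have "C.ip n (e j) (e k) = (if j = k then 1 else 0)" if "j \<in> S" "k \<in> S" for j k
    proof (cases "j \<in> C")
      case j: True
      show ?thesis
      proof (cases "k \<in> C")
        case k: True
        have "C.ip n (e j) (e k) = (\<Sum>i\<in>R. cnj (e j i) * e k i)"
          unfolding C.ip_def using R j k by (intro sum.mono_neutral_right) (auto simp: e_def)
        also have "\<dots> = (\<Sum>i\<in>R. cnj (u i j) * u i k)" using j k by (intro sum.cong) (auto simp: e_def)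
        finally show ?thesis using u[OF j k] by simp
      next
        case k: False
        then have "C.ip n (e j) (e k) = 0" unfolding C.ip_def
          using j \<sigma>'[OF that(2) k] by (intro sum.neutral) (auto simp: e_def C.unit_vec_def)
        then show ?thesis using j k by auto
      qed
    next
      case j: False
      show ?thesis
      proof (cases "k \<in> C")
        case k: True
        then have "C.ip n (e j) (e k) = 0" unfolding C.ip_def
          using j \<sigma>'[OF that(1) j] by (intro sum.neutral) (auto simp: e_def C.unit_vec_def)
        then show ?thesis using j k by auto
      next
        case k: False
        have "C.ip n (C.unit_vec (\<sigma> j)) (C.unit_vec (\<sigma> k)) = (if \<sigma> j = \<sigma> k then 1 else 0)"
          using C.onf_unit_vec[of n] \<sigma>'[OF that(1) j] \<sigma>'[OF that(2) k] unfolding C.onf_def by auto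
        moreover have "\<sigma> j = \<sigma> k \<longleftrightarrow> j = k" using \<sigma>(1) that j k by (auto simp: inj_on_def)
        ultimately show ?thesis using j k by (simp add: e_def)
      qed
    qed
    ultimately show ?thesis unfolding C.onf_def by blast
  qed
  then obtain f where f: "C.onf n {..<n} f" "\<forall>j\<in>S. f j = e j" using C.onf_extend[OF S(1)] by blast
  define g where "g = (\<lambda>i r. if r < n then f r i else 0)"
  have "f r i = 0" if "r < n" "\<not> i < n" for r i
    using f(1) that unfolding C.onf_def C.vecs_def by auto
  then have gm: "g \<in> mats n" by (auto simp: g_def mats_def)
  have "C.onf n {..<n} (\<lambda>r i. g i r)" using f(1) unfolding C.onf_def g_def by simp
  then have gu: "g \<in> unitary_group n" using gm unitary_iff_onf by blast
  have ge: "g i j = e j i" if "j \<in> S" for i j using f(2) that S(1) by (auto simp: g_def)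
  have "\<forall>j\<in>C. \<forall>i. g i j = (if i \<in> R then u i j else 0)" using ge S(2) by (auto simp: e_def)
  moreover have "\<forall>j\<in>S - C. \<sigma> j \<notin> R \<and> (\<forall>i. g i j = (if i = \<sigma> j then 1 else 0))"
    using ge \<sigma>' by (auto simp: e_def C.unit_vec_def)
  ultimately show ?thesis using gu by blast
qed

text \<open>A class closed under products in which a real trace over \<open>{..<n}\<close> forces a
  real trace over \<open>C\<close>. It removes the padding columns from all trace
  computations.\<close>

definition real_off :: "nat set \<Rightarrow> (nat \<Rightarrow> nat \<Rightarrow> complex) set" where
  "real_off C = {X. (\<forall>j k. (j \<in> C) \<noteq> (k \<in> C) \<longrightarrow> X j k = 0) \<and> (\<forall>j k. j \<notin> C \<longrightarrow> k \<notin> C \<longrightarrow> X j k \<in> \<real>)}"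

lemma real_off_mmul_inside:
  assumes "X \<in> real_off C" "C \<subseteq> {..<n}" "j \<in> C" "k \<in> C"
  shows "mmul n X Y j k = (\<Sum>l\<in>C. X j l * Y l k)"
proof -
  have "mmul n X Y j k = (\<Sum>l<n. X j l * Y l k)" using assms by (auto simp: mmul_def)
  also have "\<dots> = (\<Sum>l\<in>C. X j l * Y l k)"
    using assms by (intro sum.mono_neutral_right) (auto simp: real_off_def)
  finally show ?thesis .
qed

lemma real_off_mmul:
  assumes X: "X \<in> real_off C" and Y: "Y \<in> real_off C"
  shows "mmul n X Y \<in> real_off C"
proof -
  have "X j l * Y l k = 0" if "(j \<in> C) \<noteq> (k \<in> C)" for j k l
    using X Y that by (cases "(j \<in> C) = (l \<in> C)") (auto simp: real_off_def)
  then have "mmul n X Y j k = 0" if "(j \<in> C) \<noteq> (k \<in> C)" for j k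
    using that by (simp add: mmul_def sum.neutral)
  moreover have "X j l * Y l k \<in> \<real>" if "j \<notin> C" "k \<notin> C" for j k l
    using X Y that by (cases "l \<in> C") (auto simp: real_off_def)
  then have "mmul n X Y j k \<in> \<real>" if "j \<notin> C" "k \<notin> C" for j k
    using that by (simp add: mmul_def sum_in_Reals)
  ultimately show ?thesis by (auto simp: real_off_def)
qed

lemma real_off_trace:
  assumes "X \<in> real_off C" "C \<subseteq> {..<n}" "mtrace n X \<in> \<real>"
  shows "(\<Sum>j\<in>C. X j j) \<in> \<real>"
proof -
  have "mtrace n X = (\<Sum>j\<in>{..<n} - C. X j j) + (\<Sum>j\<in>C. X j j)"
    unfolding mtrace_def using assms(2) by (intro sum.subset_diff) auto
  then have "(\<Sum>j\<in>C. X j j) = mtrace n X - (\<Sum>j\<in>{..<n} - C. X j j)" by simp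
  also have "\<dots> \<in> \<real>" using assms by (intro Reals_diff sum_in_Reals) (auto simp: real_off_def)
  finally show ?thesis .
qed

text \<open>Spreads the indices of a small configuration over the blocks, \<open>s\<close> to each,
  so that \<open>i div s\<close> decides which block an index belongs to.\<close>

definition block_pos :: "nat list \<Rightarrow> nat \<Rightarrow> nat \<Rightarrow> nat" where
  "block_pos ns s i = sum_list (take (i div s) ns) + i mod s"

lemma block_pos:
  assumes "0 < s" "\<forall>x\<in>set ns. s \<le> x" "i div s < length ns"
  shows "block_pos ns s i \<in> block ns (i div s)"
proof -
  have "i mod s < ns ! (i div s)" using assms mod_less_divisor[of s i] nth_mem[of "i div s" ns] by fastforce
  then have *: "block_pos ns s i < sum_list (take (Suc (i div s)) ns)"
    using assms(3) by (simp add: block_pos_def take_Suc_conv_app_nth)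
  then have "block_pos ns s i < sum_list ns" using sum_list_take_le order_less_le_trans by blast
  then show ?thesis using * block_of_eq_iff[of "block_pos ns s i" ns "i div s"]
    by (auto simp: block_def block_pos_def)
qed

lemma inj_on_block_pos:
  assumes "0 < s" "\<forall>x\<in>set ns. s \<le> x" "\<And>i. i < r \<Longrightarrow> i div s < length ns"
  shows "inj_on (block_pos ns s) {..<r}"
proof (rule inj_onI)
  fix i j assume ij: "i \<in> {..<r}" "j \<in> {..<r}" "block_pos ns s i = block_pos ns s j"
  have "block_pos ns s i \<in> block ns (i div s)" "block_pos ns s j \<in> block ns (j div s)"
    using block_pos[OF assms(1,2) assms(3)] ij(1,2) by (simp_all only: lessThan_iff)
  then have d: "i div s = j div s" using ij(3) by (auto simp: block_def)
  then have "i mod s = j mod s" using ij(3) by (simp add: block_pos_def)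
  then show "i = j" using d by (metis div_mult_mod_eq)
qed

text \<open>The configuration: \<open>r\<close> rows, \<open>s\<close> in each of the first blocks of \<open>ns\<close>, and the
  \<open>q * t\<close> columns in the first \<open>q\<close> blocks of \<open>ms\<close> (\<open>t\<close> in each) carry a
  matrix with orthonormal columns; all other columns of these \<open>q\<close> blocks are standard basis vectors.
  The weights \<open>wt\<close> are the squares of common factors of the rows, which keeps square roots out of
  the entries \<open>T\<close>.\<close>

lemma triple_product_real_traces:
  fixes T :: "nat \<Rightarrow> nat \<Rightarrow> complex" and wt :: "nat \<Rightarrow> real"
  assumes n: "sum_list ns = n" "sum_list ms = n" and tp: "triple_product n ns ms"
    and s: "0 < s" "\<forall>x\<in>set ns. s \<le> x" "\<And>i. i < r \<Longrightarrow> i div s < length ns"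
    and t: "0 < t" "\<forall>x\<in>set ms. t \<le> x" "\<And>i. i < r \<Longrightarrow> i div t < length ms"
    and q: "q * t \<le> r" and wt: "\<And>i. i < r \<Longrightarrow> 0 \<le> wt i"
    and orth: "\<And>j k. j < q * t \<Longrightarrow> k < q * t \<Longrightarrow>
      (\<Sum>i<r. complex_of_real (wt i) * (cnj (T i j) * T i k)) = (if j = k then 1 else 0)"
  obtains P :: "(nat \<Rightarrow> nat \<Rightarrow> complex) set" where
    "\<And>b a c. b < q \<Longrightarrow> c < q \<Longrightarrow> \<exists>X\<in>P. \<forall>j<q*t. \<forall>k<q*t. X j k =
       (if j div t = b \<and> k div t = c then
         (\<Sum>i<r. if i div s = a then complex_of_real (wt i) * (cnj (T i j) * T i k) else 0) else 0)"
    "\<And>X Y. X \<in> P \<Longrightarrow> Y \<in> P \<Longrightarrow> \<exists>Z\<in>P. \<forall>j<q*t. \<forall>k<q*t. Z j k = (\<Sum>l<q*t. X j l * Y l k)"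
    "\<And>X. X \<in> P \<Longrightarrow> (\<Sum>j<q*t. X j j) \<in> \<real>"
proof -
  let ?\<rho> = "block_pos ns s" and ?\<kappa> = "block_pos ms t"
  define R where "R = ?\<rho> ` {..<r}"
  \<comment> \<open>Of these \<open>r\<close> column slots only the first \<open>q * t\<close> lie
    in the first \<open>q\<close> blocks; the others sit in later blocks and guarantee enough free
    rows for the padding.\<close>
  define D where "D = ?\<kappa> ` {..<r}"
  define C where "C = ?\<kappa> ` {..<q * t}"
  define S where "S = (\<Union>b<q. block ms b)"
  define u where "u = (\<lambda>x y. complex_of_real (sqrt (wt (the_inv_into {..<r} ?\<rho> x))) *
     T (the_inv_into {..<r} ?\<rho> x) (the_inv_into {..<r} ?\<kappa> y))"
  have inj\<rho>: "inj_on ?\<rho> {..<r}" using inj_on_block_pos[OF s] .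
  have inj\<kappa>: "inj_on ?\<kappa> {..<r}" using inj_on_block_pos[OF t] .
  have inj\<kappa>': "inj_on ?\<kappa> {..<q * t}" using inj_on_subset[OF inj\<kappa>] q by auto
  have \<rho>: "?\<rho> i \<in> block ns (i div s)" if "i < r" for i using block_pos[OF s(1,2)] s(3) that by blast
  have \<kappa>: "?\<kappa> i \<in> block ms (i div t)" if "i < r" for i using block_pos[OF t(1,2)] t(3) that by blast
  have uv: "u (?\<rho> i) (?\<kappa> j) = complex_of_real (sqrt (wt i)) * T i j" if "i < r" "j < r" for i j
    using that by (simp add: u_def the_inv_into_f_f inj\<rho> inj\<kappa>)
  have uu: "cnj (u (?\<rho> i) (?\<kappa> j)) * u (?\<rho> i) (?\<kappa> k) = complex_of_real (wt i) * (cnj (T i j) * T i k)"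
    if "i < r" "j < r" "k < r" for i j k
  proof -
    have "cnj (u (?\<rho> i) (?\<kappa> j)) * u (?\<rho> i) (?\<kappa> k) =
      complex_of_real (sqrt (wt i) * sqrt (wt i)) * (cnj (T i j) * T i k)"
      unfolding uv[OF that(1,2)] uv[OF that(1,3)] of_real_mult complex_cnj_mult complex_cnj_complex_of_real
      by (simp only: mult_ac)
    then show ?thesis using wt[OF that(1)] by simp
  qed
  have Sn: "S \<subseteq> {..<n}" using block_subset[OF n(2)] by (auto simp: S_def)
  have SD: "S \<inter> D = C"
  proof -
    have "?\<kappa> j \<in> S \<longleftrightarrow> j < q * t" if "j < r" for j
    proof -
      have "?\<kappa> j \<in> S \<longleftrightarrow> j div t < q" using \<kappa>[OF that] by (auto simp: S_def block_def)
      then show ?thesis using t(1) by (simp add: div_less_iff_less_mult)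
    qed
    then show ?thesis using q by (auto simp: D_def C_def)
  qed
  have CS: "C \<subseteq> S" using SD by auto
  have Cn: "C \<subseteq> {..<n}" using CS Sn by auto
  have Rn: "R \<subseteq> {..<n}" using \<rho> block_subset[OF n(1)] by (auto simp: R_def)
  have Dn: "D \<subseteq> {..<n}" using \<kappa> block_subset[OF n(2)] by (auto simp: D_def)
  have "card D = card R" using inj\<rho> inj\<kappa> by (simp add: D_def R_def card_image)
  moreover have "(\<Sum>i\<in>R. cnj (u i j) * u i k) = (if j = k then 1 else 0)" if jk: "j \<in> C" "k \<in> C" for j k
  proof -
    obtain j' k' where jk': "j = ?\<kappa> j'" "k = ?\<kappa> k'" "j' < q * t" "k' < q * t" using jk by (auto simp: C_def)
    have "(\<Sum>i\<in>R. cnj (u i j) * u i k) = (\<Sum>i<r. cnj (u (?\<rho> i) j) * u (?\<rho> i) k)"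
      unfolding R_def using inj\<rho> by (simp add: sum.reindex)
    also have "\<dots> = (\<Sum>i<r. complex_of_real (wt i) * (cnj (T i j') * T i k'))"
      unfolding jk'(1,2) using jk'(3,4) q uu by (intro sum.cong) auto
    also have "\<dots> = (if j' = k' then 1 else 0)" using orth jk' by simp
    also have "j' = k' \<longleftrightarrow> j = k" using jk' inj\<kappa>' by (auto simp: inj_on_def)
    finally show ?thesis .
  qed
  ultimately obtain g \<sigma> where g: "g \<in> unitary_group n" "\<forall>j\<in>C. \<forall>i. g i j = (if i \<in> R then u i j else 0)"
    "\<forall>j\<in>S - C. \<sigma> j \<notin> R \<and> (\<forall>i. g i j = (if i = \<sigma> j then 1 else 0))"
    using exists_unitary_with_columns[OF Sn CS Rn Dn _ SD, of u] by blast
  obtain z where z: "z \<in> unitary_group n" "\<And>b a c. block_gram n ns ms g b a c \<in> conj_by n z"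
    using triple_product_real_words[OF n tp g(1)] by blast
  have gs: "gram n (block ns a) g j k = (\<Sum>i\<in>block ns a. cnj (g i j) * g i k)" if "j \<in> S" "k \<in> S" for a j k
    using that Sn block_subset[OF n(1)] by (intro gram_apply) auto
  have off: "block_gram n ns ms g b a c \<in> real_off C" if bc: "b < q" "c < q" for b a c
  proof -
    have bS: "block ms b \<subseteq> S" "block ms c \<subseteq> S" using bc by (auto simp: S_def)
    have "block_gram n ns ms g b a c j k = 0" if "(j \<in> C) \<noteq> (k \<in> C)" for j k
    proof (cases "j \<in> block ms b \<and> k \<in> block ms c")
      case True
      then have jk: "j \<in> S" "k \<in> S" using bS by auto
      have "cnj (g i j) * g i k = 0" for i using that g(2,3) jk by (cases "j \<in> C") auto
      then show ?thesis using True gs[OF jk] by (simp add: block_gram_def sum.neutral)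
    qed (auto simp: block_gram_def)
    moreover have "block_gram n ns ms g b a c j k \<in> \<real>" if "j \<notin> C" "k \<notin> C" for j k
    proof (cases "j \<in> block ms b \<and> k \<in> block ms c")
      case True
      then have jk: "j \<in> S" "k \<in> S" using bS by auto
      have "cnj (g i j) * g i k \<in> \<real>" for i using that g(3) jk by auto
      then show ?thesis using True gs[OF jk] by (simp add: block_gram_def sum_in_Reals)
    qed (auto simp: block_gram_def)
    ultimately show ?thesis by (auto simp: real_off_def)
  qed
  \<comment> \<open>\<open>PP\<close> consists of matrices of size \<open>n\<close>;
    \<open>P\<close> reads off their entries at the \<open>q * t\<close> chosen columns, so that the
    applications compute with small numerical matrices only.\<close>
  define PP where "PP = conj_by n z \<inter> real_off C"
  define P where "P = (\<lambda>X j k. X (?\<kappa> j) (?\<kappa> k)) ` PP"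
  show thesis
  proof (rule that[of P])
    fix b a c assume bc: "b < q" "c < q"
    let ?X = "block_gram n ns ms g b a c"
    have "?X (?\<kappa> j) (?\<kappa> k) = (if j div t = b \<and> k div t = c then
         (\<Sum>i<r. if i div s = a then complex_of_real (wt i) * (cnj (T i j) * T i k) else 0) else 0)"
      if jk: "j < q * t" "k < q * t" for j k
    proof -
      have kk: "?\<kappa> j \<in> block ms b \<longleftrightarrow> j div t = b" "?\<kappa> k \<in> block ms c \<longleftrightarrow> k div t = c"
        using \<kappa>[of j] \<kappa>[of k] jk q by (auto simp: block_def)
      have jC: "?\<kappa> j \<in> C" "?\<kappa> k \<in> C" using jk by (auto simp: C_def)
      have "gram n (block ns a) g (?\<kappa> j) (?\<kappa> k) = (\<Sum>x\<in>block ns a. cnj (g x (?\<kappa> j)) * g x (?\<kappa> k))"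
        using jC CS by (intro gs) auto
      also have "\<dots> = (\<Sum>x\<in>block ns a \<inter> R. cnj (g x (?\<kappa> j)) * g x (?\<kappa> k))"
        using g(2) jC by (intro sum.mono_neutral_right) auto
      also have "block ns a \<inter> R = ?\<rho> ` {i. i < r \<and> i div s = a}"
        using \<rho> by (fastforce simp: R_def block_def)
      also have "(\<Sum>x\<in>\<dots>. cnj (g x (?\<kappa> j)) * g x (?\<kappa> k)) =
          (\<Sum>i\<in>{i. i < r \<and> i div s = a}. cnj (g (?\<rho> i) (?\<kappa> j)) * g (?\<rho> i) (?\<kappa> k))"
        by (subst sum.reindex) (auto intro: inj_on_subset[OF inj\<rho>])
      also have "\<dots> = (\<Sum>i\<in>{i. i < r \<and> i div s = a}. complex_of_real (wt i) * (cnj (T i j) * T i k))"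
        using g(2) jC jk q uu by (intro sum.cong) (auto simp: R_def)
      also have "\<dots> = (\<Sum>i<r. if i div s = a then complex_of_real (wt i) * (cnj (T i j) * T i k) else 0)"
        by (simp add: sum.If_cases) (intro sum.cong; auto)
      finally show ?thesis using kk by (simp add: block_gram_def)
    qed
    moreover have "?X \<in> PP" using z off[OF bc] by (simp add: PP_def)
    ultimately show "\<exists>X\<in>P. \<forall>j<q*t. \<forall>k<q*t. X j k = (if j div t = b \<and> k div t = c then
         (\<Sum>i<r. if i div s = a then complex_of_real (wt i) * (cnj (T i j) * T i k) else 0) else 0)"
      unfolding P_def by (intro bexI[OF _ imageI[of ?X]]) auto
  next
    fix X Y assume "X \<in> P" "Y \<in> P"
    then obtain X' Y' where XY: "X' \<in> PP" "Y' \<in> PP" "X = (\<lambda>j k. X' (?\<kappa> j) (?\<kappa> k))" "Y = (\<lambda>j k. Y' (?\<kappa> j) (?\<kappa> k))"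
      by (auto simp: P_def)
    have "mmul n X' Y' \<in> PP"
      using XY conj_by_mmul[OF z(1)] real_off_mmul by (auto simp: PP_def)
    moreover have "mmul n X' Y' (?\<kappa> j) (?\<kappa> k) = (\<Sum>l<q*t. X j l * Y l k)" if "j < q * t" "k < q * t" for j k
    proof -
      have "mmul n X' Y' (?\<kappa> j) (?\<kappa> k) = (\<Sum>l\<in>C. X' (?\<kappa> j) l * Y' l (?\<kappa> k))"
        using XY Cn that by (intro real_off_mmul_inside) (auto simp: PP_def C_def)
      also have "\<dots> = (\<Sum>l<q*t. X j l * Y l k)"
        unfolding C_def using inj\<kappa>' XY by (simp add: sum.reindex)
      finally show ?thesis .
    qed
    ultimately show "\<exists>Z\<in>P. \<forall>j<q*t. \<forall>k<q*t. Z j k = (\<Sum>l<q*t. X j l * Y l k)"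
      unfolding P_def by (intro bexI[OF _ imageI[of "mmul n X' Y'"]]) auto
  next
    fix X assume "X \<in> P"
    then obtain X' where X: "X' \<in> PP" "X = (\<lambda>j k. X' (?\<kappa> j) (?\<kappa> k))" by (auto simp: P_def)
    have "(\<Sum>j\<in>C. X' j j) \<in> \<real>"
      using X Cn conj_by_trace_real[OF z(1)] by (intro real_off_trace) (auto simp: PP_def)
    then show "(\<Sum>j<q*t. X j j) \<in> \<real>"
      unfolding C_def using inj\<kappa>' X by (simp add: sum.reindex)
  qed
qed

text \<open>Orthogonality of the two columns is the closed triangle \<open>3 + 4 \<i> + 5 z = 0\<close>, where \<open>|z| = 1\<close>
  since its sides are 3, 4 and 5.\<close>

lemma not_triple_product_three_three:
  assumes n: "sum_list ns = n" "sum_list ms = n" and pos: "\<forall>x\<in>set ns. 1 \<le> x" "\<forall>x\<in>set ms. 1 \<le> x"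
    and len: "3 \<le> length ns" "3 \<le> length ms"
  shows "\<not> triple_product n ns ms"
proof
  assume tp: "triple_product n ns ms"
  define wt :: "nat \<Rightarrow> real" where "wt = (\<lambda>i. [1/4, 1/3, 5/12] ! i)"
  define T :: "nat \<Rightarrow> nat \<Rightarrow> complex" where "T = (\<lambda>i j. [[1, 1], [1, \<i>], [1, - (3 + 4 * \<i>) / 5]] ! i ! j)"
  have 3: "{..<3::nat} = {0, 1, 2}" and 2: "{..<2::nat} = {0, 1}" by auto
  have orth: "(\<Sum>i<3. complex_of_real (wt i) * (cnj (T i j) * T i k)) = (if j = k then 1 else 0)"
    if "j < 2 * 1" "k < 2 * 1" for j k
  proof -
    have "j \<in> {..<2}" "k \<in> {..<2}" using that by auto
    then show ?thesis unfolding 2 3 by (auto simp: wt_def T_def complex_eq_iff field_simps)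
  qed
  have wt: "0 \<le> wt i" if "i < 3" for i
  proof -
    have "i \<in> {..<3}" using that by simp
    then show ?thesis unfolding 3 by (auto simp: wt_def)
  qed
  obtain P where P: "\<And>b a c. b < 2 \<Longrightarrow> c < 2 \<Longrightarrow> \<exists>X\<in>P. \<forall>j<2*1. \<forall>k<2*1. X j k =
       (if j div 1 = b \<and> k div 1 = c then
         (\<Sum>i<3. if i div 1 = a then complex_of_real (wt i) * (cnj (T i j) * T i k) else 0) else 0)"
    "\<And>X Y. X \<in> P \<Longrightarrow> Y \<in> P \<Longrightarrow> \<exists>Z\<in>P. \<forall>j<2*1. \<forall>k<2*1. Z j k = (\<Sum>l<2*1. X j l * Y l k)"
    "\<And>X. X \<in> P \<Longrightarrow> (\<Sum>j<2*1. X j j) \<in> \<real>"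
    \<comment> \<open>One row in each of three blocks and one column in each of two; the third
      column slot lies in a third block of \<open>ms\<close>.\<close>
    by (rule triple_product_real_traces[OF n tp, of 1 3 1 2 wt T]) (use pos len wt orth in auto)
  \<comment> \<open>Opposite corners for two different rows: the trace of their product does not
    change under independent phases of the two columns.\<close>
  obtain X where X: "X \<in> P" "\<forall>j<2. \<forall>k<2. X j k =
       (if j = 0 \<and> k = 1 then (\<Sum>i<3. if i = 0 then complex_of_real (wt i) * (cnj (T i j) * T i k) else 0) else 0)"
    using P(1)[of 0 1 0] by auto
  obtain Y where Y: "Y \<in> P" "\<forall>j<2. \<forall>k<2. Y j k =
       (if j = 1 \<and> k = 0 then (\<Sum>i<3. if i = 1 then complex_of_real (wt i) * (cnj (T i j) * T i k) else 0) else 0)"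
    using P(1)[of 1 0 1] by auto
  obtain Z where Z: "Z \<in> P" "\<forall>j<2. \<forall>k<2. Z j k = (\<Sum>l<2. X j l * Y l k)"
    using P(2)[OF X(1) Y(1)] by auto
  have "(\<Sum>j<2. Z j j) \<in> \<real>" using P(3)[OF Z(1)] by simp
  moreover have "(\<Sum>j<2. Z j j) = - \<i> / 12"
    using X(2) Y(2) Z(2) unfolding 2 3 by (simp add: wt_def T_def)
  ultimately show False by (simp add: complex_is_Real_iff)
qed

text \<open>The rows are spinors of the three coordinate axes and of \<open>- (1, 2, 2) / 3\<close> on the Bloch sphere; the
  trace is not real because the axes are not coplanar.\<close>

lemma not_triple_product_four_two:
  assumes n: "sum_list ns = n" "sum_list ms = n" and pos: "\<forall>x\<in>set ns. 1 \<le> x" "\<forall>x\<in>set ms. 2 \<le> x"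
    and len: "4 \<le> length ns" "2 \<le> length ms"
  shows "\<not> triple_product n ns ms"
proof
  assume tp: "triple_product n ns ms"
  \<comment> \<open>The weighted Gram matrices of the rows have traces 1/4, 1/2, 1/2, 3/4. These add
    up to 2 and balance the four Bloch vectors, so the sum of the matrices is the identity.\<close>
  define wt :: "nat \<Rightarrow> real" where "wt = (\<lambda>i. [1/8, 1/4, 1/2, 1/8] ! i)"
  define T :: "nat \<Rightarrow> nat \<Rightarrow> complex" where "T = (\<lambda>i j. [[1, 1], [1, - \<i>], [1, 0], [1, - 1 + 2 * \<i>]] ! i ! j)"
  have 4: "{..<4::nat} = {0, 1, 2, 3}" and 2: "{..<2::nat} = {0, 1}" by auto
  have orth: "(\<Sum>i<4. complex_of_real (wt i) * (cnj (T i j) * T i k)) = (if j = k then 1 else 0)"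
    if "j < 1 * 2" "k < 1 * 2" for j k
  proof -
    have "j \<in> {..<2}" "k \<in> {..<2}" using that by auto
    then show ?thesis unfolding 2 4 by (auto simp: wt_def T_def complex_eq_iff field_simps)
  qed
  have wt: "0 \<le> wt i" if "i < 4" for i
  proof -
    have "i \<in> {..<4}" using that by simp
    then show ?thesis unfolding 4 by (auto simp: wt_def)
  qed
  obtain P where P: "\<And>b a c. b < 1 \<Longrightarrow> c < 1 \<Longrightarrow> \<exists>X\<in>P. \<forall>j<1*2. \<forall>k<1*2. X j k =
       (if j div 2 = b \<and> k div 2 = c then
         (\<Sum>i<4. if i div 1 = a then complex_of_real (wt i) * (cnj (T i j) * T i k) else 0) else 0)"
    "\<And>X Y. X \<in> P \<Longrightarrow> Y \<in> P \<Longrightarrow> \<exists>Z\<in>P. \<forall>j<1*2. \<forall>k<1*2. Z j k = (\<Sum>l<1*2. X j l * Y l k)"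
    "\<And>X. X \<in> P \<Longrightarrow> (\<Sum>j<1*2. X j j) \<in> \<real>"
    by (rule triple_product_real_traces[OF n tp, of 1 4 2 1 wt T]) (use pos len wt orth in auto)
  have XX: "\<exists>X\<in>P. \<forall>j<2. \<forall>k<2. X j k = complex_of_real (wt a) * (cnj (T a j) * T a k)" if "a < 4" for a
    using P(1)[of 0 0 a] that by simp
  obtain X where X: "X \<in> P" "\<forall>j<2. \<forall>k<2. X j k = complex_of_real (wt 0) * (cnj (T 0 j) * T 0 k)"
    using XX[of 0] by auto
  obtain Y where Y: "Y \<in> P" "\<forall>j<2. \<forall>k<2. Y j k = complex_of_real (wt 1) * (cnj (T 1 j) * T 1 k)"
    using XX[of 1] by auto
  obtain Z where Z: "Z \<in> P" "\<forall>j<2. \<forall>k<2. Z j k = complex_of_real (wt 2) * (cnj (T 2 j) * T 2 k)"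
    using XX[of 2] by auto
  obtain U where U: "U \<in> P" "\<forall>j<2. \<forall>k<2. U j k = (\<Sum>l<2. X j l * Y l k)"
    using P(2)[OF X(1) Y(1)] by auto
  obtain V where V: "V \<in> P" "\<forall>j<2. \<forall>k<2. V j k = (\<Sum>l<2. U j l * Z l k)"
    using P(2)[OF U(1) Z(1)] by auto
  have "(\<Sum>j<2. V j j) \<in> \<real>" using P(3)[OF V(1)] by simp
  moreover have X': "X 0 0 = 1/8" "X 0 1 = 1/8" "X 1 0 = 1/8" "X 1 1 = 1/8"
    by (simp_all add: X(2) wt_def T_def)
  have Y': "Y 0 0 = 1/4" "Y 0 1 = - \<i>/4" "Y 1 0 = \<i>/4" "Y 1 1 = 1/4"
    by (simp_all add: Y(2) wt_def T_def)
  have Z': "Z 0 0 = 1/2" "Z 0 1 = 0" "Z 1 0 = 0" "Z 1 1 = 0"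
    by (simp_all add: Z(2) wt_def T_def)
  have "Im (\<Sum>j<2. V j j) \<noteq> 0"
    using U(2) V(2) unfolding 2 by (simp add: X' Y' Z' del: One_nat_def)
  ultimately show False by (simp add: complex_is_Real_iff)
qed

text \<open>The first Gram matrix is diagonal with distinct eigenvalues, so only diagonal unitary matrices are
  available to make the second one, \<open>Y\<close>, real; they do not change \<open>Y\<^sub>0\<^sub>1 Y\<^sub>1\<^sub>2 Y\<^sub>2\<^sub>0\<close>, which is not
  real. The rows 4 and 5 factor the semidefinite matrix of rank two that remains.\<close>

lemma not_triple_product_three_two:
  assumes n: "sum_list ns = n" "sum_list ms = n" and pos: "\<forall>x\<in>set ns. 2 \<le> x" "\<forall>x\<in>set ms. 3 \<le> x"
    and len: "3 \<le> length ns" "2 \<le> length ms"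
  shows "\<not> triple_product n ns ms"
proof
  assume tp: "triple_product n ns ms"
  \<comment> \<open>Each block of \<open>ns\<close> supplies two rows, so all three Gram matrices
    have rank two. Rows 0 and 1 give the diagonal matrix with entries 1/2, 3/4, 0; row 3 brings in
    the nonreal entry of \<open>Y\<close> at position (0, 2).\<close>
  define wt :: "nat \<Rightarrow> real" where "wt = (\<lambda>i. [1/2, 3/4, 1/8, 1/8, 1/16, 1/16] ! i)"
  define T :: "nat \<Rightarrow> nat \<Rightarrow> complex" where
    "T = (\<lambda>i j. [[1, 0, 0], [0, 1, 0], [1, 1, 1], [1, 0, \<i>], [2, - 1, - 1 - \<i>], [0, 1, - 3 - \<i>]] ! i ! j)"
  have 6: "{..<6::nat} = {0, 1, 2, 3, 4, 5}" and 3: "{..<3::nat} = {0, 1, 2}" by auto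
  have orth: "(\<Sum>i<6. complex_of_real (wt i) * (cnj (T i j) * T i k)) = (if j = k then 1 else 0)"
    if "j < 1 * 3" "k < 1 * 3" for j k
  proof -
    have "j \<in> {..<3}" "k \<in> {..<3}" using that by auto
    then show ?thesis unfolding 3 6 by (auto simp: wt_def T_def complex_eq_iff field_simps)
  qed
  have wt: "0 \<le> wt i" if "i < 6" for i
  proof -
    have "i \<in> {..<6}" using that by simp
    then show ?thesis unfolding 6 by (auto simp: wt_def)
  qed
  obtain P where P: "\<And>b a c. b < 1 \<Longrightarrow> c < 1 \<Longrightarrow> \<exists>X\<in>P. \<forall>j<1*3. \<forall>k<1*3. X j k =
       (if j div 3 = b \<and> k div 3 = c then
         (\<Sum>i<6. if i div 2 = a then complex_of_real (wt i) * (cnj (T i j) * T i k) else 0) else 0)"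
    "\<And>X Y. X \<in> P \<Longrightarrow> Y \<in> P \<Longrightarrow> \<exists>Z\<in>P. \<forall>j<1*3. \<forall>k<1*3. Z j k = (\<Sum>l<1*3. X j l * Y l k)"
    "\<And>X. X \<in> P \<Longrightarrow> (\<Sum>j<1*3. X j j) \<in> \<real>"
    by (rule triple_product_real_traces[OF n tp, of 2 6 3 1 wt T]) (use pos len wt orth in auto)
  obtain X where X: "X \<in> P" "\<forall>j<3. \<forall>k<3. X j k =
      (\<Sum>i<6. if i div 2 = 0 then complex_of_real (wt i) * (cnj (T i j) * T i k) else 0)"
    using P(1)[of 0 0 0] by auto
  obtain Y where Y: "Y \<in> P" "\<forall>j<3. \<forall>k<3. Y j k =
      (\<Sum>i<6. if i div 2 = 1 then complex_of_real (wt i) * (cnj (T i j) * T i k) else 0)"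
    using P(1)[of 0 0 1] by auto
  have X': "X 0 0 = 1/2" "X 0 1 = 0" "X 0 2 = 0" "X 1 0 = 0" "X 1 1 = 3/4" "X 1 2 = 0"
    "X 2 0 = 0" "X 2 1 = 0" "X 2 2 = 0"
    using X(2) unfolding 6 by (simp_all add: wt_def T_def)
  have Y': "Y 0 0 = 1/4" "Y 0 1 = 1/8" "Y 0 2 = (1 + \<i>)/8" "Y 1 0 = 1/8" "Y 1 1 = 1/8" "Y 1 2 = 1/8"
    "Y 2 0 = (1 - \<i>)/8" "Y 2 1 = 1/8" "Y 2 2 = 1/4"
    using Y(2) unfolding 6 by (simp_all add: wt_def T_def complex_eq_iff)
  \<comment> \<open>The word to be traced is \<open>X Y X^2 Y^2\<close>, a shortest one in two
    letters that is not a cyclic rotation of its reversal; for hermitian letters, such a rotation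
    would make the trace real. With diagonal entries \<open>x0\<close>, \<open>x1\<close>, 0 of
    \<open>X\<close>, the imaginary part is \<open>x0 * x1 * (x1 - x0)\<close> times that of
    \<open>Y01 * Y12 * Y20\<close>.\<close>
  obtain XY where XY: "XY \<in> P" "\<forall>j<3. \<forall>k<3. XY j k = (\<Sum>l<3. X j l * Y l k)"
    using P(2)[OF X(1) Y(1)] by auto
  obtain X2 where X2: "X2 \<in> P" "\<forall>j<3. \<forall>k<3. X2 j k = (\<Sum>l<3. X j l * X l k)"
    using P(2)[OF X(1) X(1)] by auto
  obtain Y2 where Y2: "Y2 \<in> P" "\<forall>j<3. \<forall>k<3. Y2 j k = (\<Sum>l<3. Y j l * Y l k)"
    using P(2)[OF Y(1) Y(1)] by auto
  obtain U where U: "U \<in> P" "\<forall>j<3. \<forall>k<3. U j k = (\<Sum>l<3. XY j l * X2 l k)"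
    using P(2)[OF XY(1) X2(1)] by auto
  obtain V where V: "V \<in> P" "\<forall>j<3. \<forall>k<3. V j k = (\<Sum>l<3. U j l * Y2 l k)"
    using P(2)[OF U(1) Y2(1)] by auto
  have "(\<Sum>j<3. V j j) \<in> \<real>" using P(3)[OF V(1)] by simp
  moreover have "Im (\<Sum>j<3. V j j) \<noteq> 0"
    using XY(2) X2(2) Y2(2) U(2) V(2) unfolding 3 by (simp add: X' Y' del: One_nat_def)
  ultimately show False by (simp add: complex_is_Real_iff)
qed

section \<open>The numerical classification\<close>

lemma length_two_nth_Min:
  assumes "length ms = 2"
  obtains b where "b < 2" "ms ! b = Min (set ms)"
proof -
  have "Min (set ms) \<in> set ms" using assms by (intro Min_in) auto
  then show thesis using that assms by (metis in_set_conv_nth)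
qed

lemma triple_product_length_two:
  assumes n: "sum_list ns = n" "sum_list ms = n" and len: "2 \<le> length ns" "length ms = 2"
    and pos: "\<forall>x\<in>set ns. 0 < x" "\<forall>x\<in>set ms. 0 < x"
  shows "triple_product n ns ms \<longleftrightarrow> length ns = 2 \<or> (length ns = 3 \<and> Min (set ns) = 1)
     \<or> (length ns = 3 \<and> Min (set ms) = 2) \<or> Min (set ms) = 1"
    (is "_ \<longleftrightarrow> ?R")
proof
  obtain b where b: "b < 2" "ms ! b = Min (set ms)" using length_two_nth_Min[OF len(2)] .
  have ne: "set ns \<noteq> {}" "set ms \<noteq> {}" using len by auto
  have ge: "c \<le> Min (set xs) \<longleftrightarrow> (\<forall>x\<in>set xs. c \<le> x)" if "set xs \<noteq> {}" for c :: nat and xs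
    using that by (simp add: Min_ge_iff)
  have Mpos: "1 \<le> Min (set ns)" "1 \<le> Min (set ms)" unfolding ge[OF ne(1)] ge[OF ne(2)] using pos by (simp_all add: Suc_le_eq)
  {
    assume ?R
    moreover have "triple_product n ns ms" if k3: "length ns = 3" "Min (set ns) = 1"
    proof -
      have "Min (set ns) \<in> set ns" using ne by (intro Min_in) auto
      then obtain a where "a < 3" "ns ! a = 1" using k3 by (auto simp: in_set_conv_nth)
      then show ?thesis using triple_product_three_one[OF n len(2) that(1)] by blast
    qed
    ultimately show "triple_product n ns ms"
      using triple_product_two_two[OF n len(2)] triple_product_three_two[OF n len(2) b(1)]
        triple_product_one[OF n len(2) b(1)] b(2) by auto
  }
  assume T: "triple_product n ns ms"
  show ?R
  proof (rule ccontr)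
    assume "\<not> ?R"
    then have *: "2 \<le> Min (set ms)" "4 \<le> length ns \<or> (length ns = 3 \<and> 2 \<le> Min (set ns) \<and> 3 \<le> Min (set ms))"
      using Mpos len by linarith+
    from *(2) show False
    proof
      assume "4 \<le> length ns"
      then show False using not_triple_product_four_two[OF n] T *(1) Mpos len
        unfolding ge[OF ne(1)] ge[OF ne(2)] by simp
    next
      assume "length ns = 3 \<and> 2 \<le> Min (set ns) \<and> 3 \<le> Min (set ms)"
      then show False using not_triple_product_three_two[OF n] T len
        unfolding ge[OF ne(1)] ge[OF ne(2)] by simp
    qed
  qed
qed

theorem theoremA:
  fixes n :: nat and ns ms :: "nat list"
  assumes "length ns \<ge> 2" and "length ms \<ge> 2"
    and "\<forall>x\<in>set ns. x > 0" and "\<forall>x\<in>set ms. x > 0"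
    and "sum_list ns = n" and "sum_list ms = n"
  defines "k \<equiv> length ns" and "l \<equiv> length ms"
    and "N \<equiv> Min (set ns)" and "M \<equiv> Min (set ms)"
    and "G \<equiv> unitary_group n" and "L \<equiv> block_unitary n ns"
    and "H \<equiv> block_unitary n ms" and "G' \<equiv> orthogonal_group n"
  shows
   "((\<forall>g\<in>G. \<exists>x\<in>L. \<exists>g'\<in>G'. \<exists>h\<in>H. g = mmul n x (mmul n g' h))
     \<longleftrightarrow> (\<forall>F1\<in>cflags n ms. \<forall>F2\<in>cflags n ns. \<exists>g\<in>G. \<exists>W1\<in>rflags n ms. \<exists>W2\<in>rflags n ns.
            flag_act n g F1 = complexify_flag W1 \<and> flag_act n g F2 = complexify_flag W2))
  \<and> ((\<forall>F1\<in>cflags n ms. \<forall>F2\<in>cflags n ns. \<exists>g\<in>G. \<exists>W1\<in>rflags n ms. \<exists>W2\<in>rflags n ns.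
            flag_act n g F1 = complexify_flag W1 \<and> flag_act n g F2 = complexify_flag W2)
     \<longleftrightarrow> (\<forall>F\<in>cflags n ms. \<exists>x\<in>L. \<exists>W\<in>rflags n ms. flag_act n x F = complexify_flag W))
  \<and> ((\<forall>F\<in>cflags n ms. \<exists>x\<in>L. \<exists>W\<in>rflags n ms. flag_act n x F = complexify_flag W)
     \<longleftrightarrow> (\<forall>F\<in>cflags n ns. \<exists>h\<in>H. \<exists>W\<in>rflags n ns. flag_act n h F = complexify_flag W))
  \<and> ((\<forall>F\<in>cflags n ns. \<exists>h\<in>H. \<exists>W\<in>rflags n ns. flag_act n h F = complexify_flag W)
     \<longleftrightarrow> ((k = 2 \<and> l = 2)
        \<or> (k = 3 \<and> N = 1 \<and> l = 2)
        \<or> (k = 3 \<and> N \<ge> 2 \<and> l = 2 \<and> M = 2)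
        \<or> (l = 2 \<and> M = 1)
        \<or> (k = 2 \<and> l = 3 \<and> M = 1)
        \<or> (k = 2 \<and> N = 2 \<and> l = 3 \<and> M \<ge> 2)
        \<or> (k = 2 \<and> N = 1)))"
proof -
  note n = assms(5,6)
  have "set ns \<noteq> {}" "set ms \<noteq> {}" using assms(1,2) by auto
  then have pos: "1 \<le> N" "1 \<le> M"
    using assms(3,4) by (simp_all add: N_def M_def Suc_le_eq)
  have i: "(\<forall>g\<in>G. \<exists>x\<in>L. \<exists>g'\<in>G'. \<exists>h\<in>H. g = mmul n x (mmul n g' h)) \<longleftrightarrow> triple_product n ns ms"
    unfolding triple_product_def G_def L_def H_def G'_def ..
  have ii: "(\<forall>F1\<in>cflags n ms. \<forall>F2\<in>cflags n ns. \<exists>g\<in>G. \<exists>W1\<in>rflags n ms. \<exists>W2\<in>rflags n ns.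
            flag_act n g F1 = complexify_flag W1 \<and> flag_act n g F2 = complexify_flag W2) \<longleftrightarrow> triple_product n ns ms"
    unfolding G_def triple_product_iff_flag_pairs[OF n] ..
  have ii': "(\<forall>F\<in>cflags n ms. \<exists>x\<in>L. \<exists>W\<in>rflags n ms. flag_act n x F = complexify_flag W) \<longleftrightarrow> triple_product n ns ms"
    unfolding L_def triple_product_iff_flags[OF n] ..
  have ii'': "(\<forall>F\<in>cflags n ns. \<exists>h\<in>H. \<exists>W\<in>rflags n ns. flag_act n h F = complexify_flag W) \<longleftrightarrow> triple_product n ns ms"
    unfolding H_def triple_product_commute[of n ns ms] triple_product_iff_flags[OF n(2,1)] ..
  have iii: "triple_product n ns ms \<longleftrightarrow> ((k = 2 \<and> l = 2)
        \<or> (k = 3 \<and> N = 1 \<and> l = 2)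
        \<or> (k = 3 \<and> N \<ge> 2 \<and> l = 2 \<and> M = 2)
        \<or> (l = 2 \<and> M = 1)
        \<or> (k = 2 \<and> l = 3 \<and> M = 1)
        \<or> (k = 2 \<and> N = 2 \<and> l = 3 \<and> M \<ge> 2)
        \<or> (k = 2 \<and> N = 1))" (is "_ \<longleftrightarrow> ?R")
  proof -
    consider "l = 2" | "k = 2" "l \<noteq> 2" | "3 \<le> k" "3 \<le> l"
      using assms(1,2) unfolding k_def l_def by linarith
    then show ?thesis
    proof cases
      case 1
      then have "triple_product n ns ms \<longleftrightarrow> k = 2 \<or> (k = 3 \<and> N = 1) \<or> (k = 3 \<and> M = 2) \<or> M = 1"
        unfolding k_def l_def N_def M_def
        using triple_product_length_two[OF n assms(1) _ assms(3,4)] by blast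
      \<comment> \<open>The shorter list has no bound on \<open>N\<close> beside
        \<open>M = 2\<close>; with \<open>k = 3\<close> and \<open>N = 1\<close> its disjunct for
        \<open>N = 1\<close> applies as well, and otherwise \<open>N\<close> is at least 2.\<close>
      also have "\<dots> \<longleftrightarrow> ?R" using 1 pos by auto
      finally show ?thesis .
    next
      case 2
      then have "triple_product n ns ms \<longleftrightarrow> l = 2 \<or> (l = 3 \<and> M = 1) \<or> (l = 3 \<and> N = 2) \<or> N = 1"
        unfolding k_def l_def N_def M_def triple_product_commute[of n ns ms]
        using triple_product_length_two[OF n(2,1) assms(2) _ assms(4,3)] by blast
      also have "\<dots> \<longleftrightarrow> ?R" using 2 pos by auto
      finally show ?thesis .
    next
      case 3
      then have "\<not> triple_product n ns ms"
        using not_triple_product_three_three[OF n] assms(3,4) by (auto simp: k_def l_def Suc_le_eq)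
      then show ?thesis using 3 by auto
    qed
  qed
  show ?thesis unfolding i ii ii' ii'' iii by simp
qed

end
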